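(* Let $r$ be a positive integer, let $Y=(y_{i,j})$ be a generic symmetric $r\times r$ matrix, $K$ an $F$-finite field of characteristic $p>0$, and $R=K[Y]$. For every integer $t$ with $1\le t\le r$, the ideal $I_t(Y)$ generated by the $t\times t$ minors of $Y$ is symbolic $F$-split. In particular, the rings $\mathcal{R}^s(I_t(Y))$ and $\mathrm{gr}^s(I_t(Y))$ are $F$-split.
   Context: Generic symmetric means $y_{i,j}=y_{j,i}$ and the $y_{i,j}$ with $i\le j$ are distinct indeterminates; $K[Y]$ is the polynomial ring in them. For an ideal $I$ of $R$ and $n\ge0$, $I^{(n)}=I^nR_S\cap R$, where $S$ is the complement of the union of the minimal primes of $I$; $\mathcal{R}^s(I)=\bigoplus_{n\ge0}I^{(n)}T^n\subseteq R[T]$ ($T$ a variable) and $\mathrm{gr}^s(I)=\bigoplus_{n\ge0}I^{(n)}/I^{(n+1)}$. The ideal $I$ is called symbolic $F$-split if there is an $R$-linear map $\phi:R^{1/p}\to R$ with $\phi|_R=\mathrm{id}_R$ (a splitting of the inclusion $R\subseteq R^{1/p}$) such that $\phi\big((I^{(np+1)})^{1/p}\big)\subseteq I^{(n+1)}$ for every $n\ge0$, where $R^{1/p}$ is the ring of $p$-th roots of elements of $R$ and $J^{1/p}=\{f^{1/p}\mid f\in J\}$. A ring $A$ of characteristic $p$ is $F$-split if the Frobenius $F:A\to A$ is a split monomorphism. A field $K$ of characteristic $p$ is $F$-finite if $[K:K^p]<\infty$. *)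

theory Defs
  imports
    "HOL-Algebra.Algebraic_Closure_Type"
    "HOL-Algebra.Embedded_Algebras"
    "HOL-Algebra.Ideal_Product"
    "HOL-Computational_Algebra.Computational_Algebra"
    "HOL-Library.Poly_Mapping"
    "HOL-Library.Product_Lexorder"
    "Jordan_Normal_Form.Determinant"
    "Jordan_Normal_Form.DL_Submatrix"
begin

text \<open>
  The rings of the theory are subrings \<open>R\<close> of an integral domain given by a type; \<open>ring_on R\<close> is
  \<open>R\<close> as a structure. Fractions of elements of \<open>R\<close> live in the type \<open>'a fract\<close>, and roots
  in the algebraic closure \<open>'a fract alg_closure\<close>.
\<close>

definition ring_on :: "'a::comm_ring_1 set \<Rightarrow> 'a ring" where
  "ring_on R = ring_of_type_algebra\<lparr>carrier := R\<rparr>"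


subsection \<open>Symbolic powers\<close>

definition minimal_primes :: "('a, 'b) ring_scheme \<Rightarrow> 'a set \<Rightarrow> 'a set set" where
  "minimal_primes A I = {P. primeideal P A \<and> I \<subseteq> P \<and>
     (\<forall>Q. primeideal Q A \<and> I \<subseteq> Q \<and> Q \<subseteq> P \<longrightarrow> Q = P)}"

text \<open>
  \<open>R\<^sub>S\<close> as a subring of the field of fractions; this is the localization because \<open>0 \<notin> S\<close>
  for the complement \<open>S\<close> of the minimal primes of a proper ideal.
\<close>

definition localization :: "'a::idom set \<Rightarrow> 'a set \<Rightarrow> 'a fract set" where
  "localization R S = {Fract a s |a s. a \<in> R \<and> s \<in> S}"

text \<open>\<open>I\<^sup>(\<^sup>n\<^sup>) = I\<^sup>n R\<^sub>S \<inter> R\<close>, the ideal \<open>I\<^sup>n R\<^sub>S\<close> being generated in \<open>R\<^sub>S\<close>.\<close>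

definition symbolic_power :: "'a::idom set \<Rightarrow> 'a set \<Rightarrow> nat \<Rightarrow> 'a set" where
  "symbolic_power R I n =
    (let S = R - \<Union>(minimal_primes (ring_on R) I);
         In = I [^]\<^bsub>ideals_set (ring_on R)\<^esub> n
     in {f \<in> R. to_fract f \<in> Idl\<^bsub>ring_on (localization R S)\<^esub> (to_fract ` In)})"

definition symbolic_Rees :: "'a::idom set \<Rightarrow> 'a set \<Rightarrow> 'a poly ring" where
  "symbolic_Rees R I = ring_on {f. \<forall>n. poly.coeff f n \<in> symbolic_power R I n}"

text \<open>
  An element of the direct sum is the function sending \<open>n\<close> to its component in
  \<open>I\<^sup>(\<^sup>n\<^sup>) / I\<^sup>(\<^sup>n\<^sup>+\<^sup>1\<^sup>)\<close>. As for \<open>rcoset_mult\<close>, the product is the union over all choices of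
  representatives.
\<close>

definition symbolic_gr :: "'a::idom set \<Rightarrow> 'a set \<Rightarrow> (nat \<Rightarrow> 'a set) ring" where
  "symbolic_gr R I =
    (let cls = (\<lambda>n x. symbolic_power R I (Suc n) +>\<^bsub>ring_on R\<^esub> x)
     in \<lparr>carrier = {G. (\<forall>n. G n \<in> cls n ` symbolic_power R I n) \<and> finite {n. G n \<noteq> cls n 0}},
         monoid.mult = (\<lambda>G H n. \<Union>{cls n (\<Sum>i\<le>n. a i * b (n - i)) |a b.
                              (\<forall>i. a i \<in> G i) \<and> (\<forall>i. b i \<in> H i)}),
         one = (\<lambda>n. cls n (if n = 0 then 1 else 0)),
         zero = (\<lambda>n. cls n 0),
         add = (\<lambda>G H n. G n <+>\<^bsub>ring_on R\<^esub> H n)\<rparr>)"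


subsection \<open>Frobenius splittings\<close>

definition has_characteristic :: "('a, 'b) ring_scheme \<Rightarrow> nat \<Rightarrow> bool" where
  "has_characteristic A p \<longleftrightarrow> (\<forall>n::nat. [n] \<cdot>\<^bsub>A\<^esub> \<one>\<^bsub>A\<^esub> = \<zero>\<^bsub>A\<^esub> \<longleftrightarrow> p dvd n)"

text \<open>
  The Frobenius is regarded as a map of \<open>A\<close>-modules from \<open>A\<close> to \<open>A\<close> with scalar multiplication
  \<open>a \<cdot> x = a\<^sup>p x\<close>; the function \<open>\<phi>\<close> is a linear left inverse of it.
\<close>

definition F_split :: "nat \<Rightarrow> ('a, 'b) ring_scheme \<Rightarrow> bool" where
  "F_split p A \<longleftrightarrow> cring A \<and> has_characteristic A p \<and>
    (\<exists>\<phi> \<in> carrier A \<rightarrow> carrier A.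
      (\<forall>x\<in>carrier A. \<forall>y\<in>carrier A. \<phi> (x \<oplus>\<^bsub>A\<^esub> y) = \<phi> x \<oplus>\<^bsub>A\<^esub> \<phi> y) \<and>
      (\<forall>a\<in>carrier A. \<forall>x\<in>carrier A. \<phi> ((a [^]\<^bsub>A\<^esub> p) \<otimes>\<^bsub>A\<^esub> x) = a \<otimes>\<^bsub>A\<^esub> \<phi> x) \<and>
      (\<forall>a\<in>carrier A. \<phi> (a [^]\<^bsub>A\<^esub> p) = a))"

text \<open>
  \<open>proots p J\<close> is \<open>J\<^bsup>1/p\<^esup>\<close>: in characteristic \<open>p\<close> every element has exactly one \<open>p\<close>-th root
  in the algebraic closure, and \<open>emb\<close> is the inclusion of \<open>R\<close> in \<open>R\<^bsup>1/p\<^esup>\<close>.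
\<close>

definition emb :: "'a::idom \<Rightarrow> 'a fract alg_closure" where
  "emb a = to_ac (to_fract a)"

definition proots :: "nat \<Rightarrow> 'a::idom set \<Rightarrow> 'a fract alg_closure set" where
  "proots p J = {x. x ^ p \<in> emb ` J}"

definition symbolic_F_split :: "nat \<Rightarrow> 'a::idom set \<Rightarrow> 'a set \<Rightarrow> bool" where
  "symbolic_F_split p R I \<longleftrightarrow>
    (\<exists>\<phi> \<in> proots p R \<rightarrow> R.
      (\<forall>x\<in>proots p R. \<forall>y\<in>proots p R. \<phi> (x + y) = \<phi> x + \<phi> y) \<and>
      (\<forall>a\<in>R. \<forall>x\<in>proots p R. \<phi> (emb a * x) = a * \<phi> x) \<and>
      (\<forall>a\<in>R. \<phi> (emb a) = a) \<and>
      (\<forall>n. \<phi> ` proots p (symbolic_power R I (n * p + 1)) \<subseteq> symbolic_power R I (n + 1)))"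

definition F_finite :: "nat \<Rightarrow> 'k::field itself \<Rightarrow> bool" where
  "F_finite p _ \<longleftrightarrow>
     ring.finite_dimension (ring_of_type_algebra :: 'k ring) (range (\<lambda>x. x ^ p)) UNIV"


subsection \<open>Minors of the generic symmetric matrix\<close>

text \<open>
  Polynomials over \<open>'k\<close> in the indeterminates \<open>y\<^sub>i\<^sub>,\<^sub>j\<close>, where \<open>(i, j)\<close> ranges over all pairs of
  natural numbers; matrix indices start at \<open>0\<close>.
\<close>

type_synonym 'k ypoly = "((nat \<times> nat) \<Rightarrow>\<^sub>0 nat) \<Rightarrow>\<^sub>0 'k"

definition indet :: "nat \<times> nat \<Rightarrow> 'k::field ypoly" where
  "indet v = Poly_Mapping.single (Poly_Mapping.single v 1) 1"

definition sym_poly_ring :: "nat \<Rightarrow> 'k::field ypoly set" where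
  "sym_poly_ring r = {f. \<forall>m\<in>Poly_Mapping.keys f. Poly_Mapping.keys m \<subseteq> {(i, j). i \<le> j \<and> j < r}}"

definition sym_mat :: "nat \<Rightarrow> 'k::field ypoly mat" where
  "sym_mat r = mat r r (\<lambda>(i, j). indet (min i j, max i j))"

definition minors :: "nat \<Rightarrow> 'a::comm_ring_1 mat \<Rightarrow> 'a set" where
  "minors t M = {det (submatrix M I J) |I J.
     I \<subseteq> {..<dim_row M} \<and> J \<subseteq> {..<dim_col M} \<and> card I = t \<and> card J = t}"

definition sym_minor_ideal :: "nat \<Rightarrow> nat \<Rightarrow> 'k::field ypoly set" where
  "sym_minor_ideal r t = Idl\<^bsub>ring_on (sym_poly_ring r)\<^esub> (minors t (sym_mat r))"

end

theory Submission
  imports Defs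
begin

text \<open>
  Let \<open>s = t - 1\<close>, let \<open>\<Delta>\<close> be the upper left \<open>s\<close>-minor, and let \<open>f\<close> be the product over
  \<open>k = 1, \<dots>, r\<close> of the minors with the first \<open>k\<close> rows and the last \<open>k\<close> columns. The diagonal
  terms of these minors involve every variable \<open>y\<^sub>i\<^sub>,\<^sub>j\<close>, \<open>i \<le> j\<close>, exactly once, and they are leading
  terms for a suitable weight. Hence the coefficient of \<open>f\<^bsup>p-1\<^esup>\<close> that a generator \<open>Tr\<close> of
  \<open>Hom(R\<^bsup>1/p\<^esup>, R)\<close> picks out is 1, and \<open>g \<mapsto> Tr(f\<^bsup>p-1\<^esup> g)\<close> splits the Frobenius.

  After inverting \<open>\<Delta>\<close> the ideal \<open>I = I\<^sub>t\<close> is generated by the \<open>h = (r - s)(r - s + 1) / 2\<close> minors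
  bordering \<open>\<Delta>\<close> (a Schur complement), a \<open>k\<close>-minor lies in \<open>I\<^bsup>k-s\<^esup>\<close>, and so \<open>f \<in> I\<^bsup>h\<^esup>\<close>. By
  the pigeonhole principle \<open>I\<^bsup>h(p-1)+np+1\<^esup> \<subseteq> (I\<^bsup>n+1\<^esup>)\<^bsup>[p]\<^esup>\<close>, which gives the condition on
  symbolic powers, since \<open>\<Delta>\<close> avoids the only minimal prime of \<open>I\<close>: the kernel of the specialization
  of \<open>Y\<close> to the generic symmetric matrix \<open>Z N Z\<^sup>T\<close> of rank \<open>s\<close>. The splitting acts on the
  components of degree divisible by \<open>p\<close> of the symbolic Rees algebra and passes to its quotient \<open>gr\<close>.
\<close>

subsection \<open>Symbolic powers in subrings of an integral domain\<close>

lemma ring_on_simps [simp]: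
  "carrier (ring_on R) = R" "monoid.mult (ring_on R) = (*)" "one (ring_on R) = 1"
  "zero (ring_on R) = 0" "add (ring_on R) = (+)"
  by (simp_all add: ring_on_def ring_of_type_algebra_def fun_eq_iff)

locale subdomain =
  fixes R :: "'a::idom set"
  assumes R_zero [simp, intro]: "0 \<in> R" and R_one [simp, intro]: "1 \<in> R"
    and R_add [intro]: "x \<in> R \<Longrightarrow> y \<in> R \<Longrightarrow> x + y \<in> R"
    and R_mult [intro]: "x \<in> R \<Longrightarrow> y \<in> R \<Longrightarrow> x * y \<in> R"
    and R_uminus [intro]: "x \<in> R \<Longrightarrow> - x \<in> R"
begin

lemma R_power [intro]: "x \<in> R \<Longrightarrow> x ^ n \<in> R"
  by (induction n) auto

lemma R_sum [intro]: "(\<And>i. i \<in> A \<Longrightarrow> f i \<in> R) \<Longrightarrow> sum f A \<in> R"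
  by (induction A rule: infinite_finite_induct) auto

lemma R_prod [intro]: "(\<And>i. i \<in> A \<Longrightarrow> f i \<in> R) \<Longrightarrow> prod f A \<in> R"
  by (induction A rule: infinite_finite_induct) auto

lemma cring_ring_on: "cring (ring_on R)"
proof (rule cringI)
  show "abelian_group (ring_on R)"
  proof (rule abelian_groupI)
    fix x assume "x \<in> carrier (ring_on R)"
    then show "\<exists>y\<in>carrier (ring_on R). y \<oplus>\<^bsub>ring_on R\<^esub> x = \<zero>\<^bsub>ring_on R\<^esub>"
      by (intro bexI[of _ "- x"]) auto
  qed (auto simp: algebra_simps)
  show "Group.comm_monoid (ring_on R)"
    by (rule comm_monoidI) (auto simp: algebra_simps)
qed (auto simp: algebra_simps)

lemma ring_ring_on: "ring (ring_on R)"
  using cring_ring_on cring.axioms(1) by blast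

lemma nat_pow_ring_on [simp]: "x [^]\<^bsub>ring_on R\<^esub> (n::nat) = x ^ n"
proof (induction n)
  case 0
  then show ?case by (simp add: nat_pow_def)
next
  case (Suc n)
  then show ?case by (simp add: nat_pow_def mult.commute)
qed

lemma add_pow_ring_on [simp]: "add_pow (ring_on R) (n::nat) x = of_nat n * x"
proof (induction n)
  case 0
  then show ?case by (simp add: add_pow_def nat_pow_def)
next
  case (Suc n)
  then show ?case by (simp add: add_pow_def nat_pow_def algebra_simps)
qed

lemma a_inv_ring_on: "x \<in> R \<Longrightarrow> \<ominus>\<^bsub>ring_on R\<^esub> x = - x"
  using abelian_group.minus_equality[OF ring.is_abelian_group[OF ring_ring_on], of "- x" x] by auto

lemma ideal_ring_on_iff:
  "ideal J (ring_on R) \<longleftrightarrow> J \<subseteq> R \<and> 0 \<in> J \<and> (\<forall>x\<in>J. \<forall>y\<in>J. x + y \<in> J) \<and> (\<forall>a\<in>R. \<forall>x\<in>J. a * x \<in> J)"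
    (is "?l \<longleftrightarrow> ?r")
proof
  assume i: ?l
  interpret ideal J "ring_on R" by fact
  show ?r
    using I_l_closed additive_subgroup.a_closed[OF ideal.axioms(1)[OF i]]
      additive_subgroup.zero_closed[OF ideal.axioms(1)[OF i]] a_subset by auto
next
  assume r: ?r
  have "subgroup J (add_monoid (ring_on R))"
  proof
    fix x assume "x \<in> J"
    then have "(- 1) * x \<in> J" using r by blast
    moreover have "inv\<^bsub>add_monoid (ring_on R)\<^esub> x = - x"
      using a_inv_ring_on[of x] r \<open>x \<in> J\<close> by (auto simp: a_inv_def)
    ultimately show "inv\<^bsub>add_monoid (ring_on R)\<^esub> x \<in> J" by simp
  qed (use r in auto)
  then show ?l
  proof (rule idealI[OF ring_ring_on])
    fix a x assume "a \<in> J" "x \<in> carrier (ring_on R)"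
    with r have "x * a \<in> J" by simp
    then show "x \<otimes>\<^bsub>ring_on R\<^esub> a \<in> J" "a \<otimes>\<^bsub>ring_on R\<^esub> x \<in> J"
      by (simp_all add: mult.commute)
  qed
qed

lemma primeideal_ring_on_iff:
  "primeideal P (ring_on R) \<longleftrightarrow> ideal P (ring_on R) \<and> 1 \<notin> P \<and>
     (\<forall>a\<in>R. \<forall>b\<in>R. a * b \<in> P \<longrightarrow> a \<in> P \<or> b \<in> P)" (is "?l \<longleftrightarrow> ?r")
proof
  assume ?l
  then interpret primeideal P "ring_on R" .
  have "1 \<notin> P" using one_imp_carrier I_notcarr by auto
  then show ?r using is_ideal I_prime by auto
next
  assume r: ?r
  then have "R \<noteq> P" by auto
  then show ?l
    using r by (intro primeidealI[OF _ cring_ring_on]) auto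
qed

section \<open>Powers of an ideal\<close>

definition ipow :: "'a set \<Rightarrow> nat \<Rightarrow> 'a set" where
  "ipow J n = J [^]\<^bsub>ideals_set (ring_on R)\<^esub> n"

lemma ipow_0 [simp]: "ipow J 0 = R"
  by (simp add: ipow_def nat_pow_def ideals_set_def)

lemma ipow_Suc: "ipow J (Suc n) = ideal_prod (ring_on R) (ipow J n) J"
  by (simp add: ipow_def nat_pow_def ideals_set_def)

lemma ideal_ipow: "ideal J (ring_on R) \<Longrightarrow> ideal (ipow J n) (ring_on R)"
proof (induction n)
  case 0
  then show ?case by (auto simp: ideal_ring_on_iff)
next
  case (Suc n)
  then show ?case
    unfolding ipow_Suc using ring.ideal_prod_is_ideal[OF ring_ring_on] by blast
qed

lemma ideal_sub: "ideal J (ring_on R) \<Longrightarrow> x \<in> J \<Longrightarrow> x \<in> R"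
  and ideal_0: "ideal J (ring_on R) \<Longrightarrow> 0 \<in> J"
  and ideal_add: "ideal J (ring_on R) \<Longrightarrow> x \<in> J \<Longrightarrow> y \<in> J \<Longrightarrow> x + y \<in> J"
  and ideal_lmult: "ideal J (ring_on R) \<Longrightarrow> a \<in> R \<Longrightarrow> x \<in> J \<Longrightarrow> a * x \<in> J"
  and ideal_rmult: "ideal J (ring_on R) \<Longrightarrow> a \<in> R \<Longrightarrow> x \<in> J \<Longrightarrow> x * a \<in> J"
  by (auto simp: ideal_ring_on_iff mult.commute)

lemma ideal_uminus: "ideal J (ring_on R) \<Longrightarrow> x \<in> J \<Longrightarrow> - x \<in> J"
  using ideal_lmult[of J "- 1" x] by auto

lemma ideal_diff: "ideal J (ring_on R) \<Longrightarrow> x \<in> J \<Longrightarrow> y \<in> J \<Longrightarrow> x - y \<in> J"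
  using ideal_add[of J x "- y"] ideal_uminus by simp

lemma ideal_sum: "ideal J (ring_on R) \<Longrightarrow> (\<And>i. i \<in> A \<Longrightarrow> f i \<in> J) \<Longrightarrow> sum f A \<in> J"
  by (induction A rule: infinite_finite_induct) (auto intro: ideal_0 ideal_add)

lemma ipow_mult:
  assumes J: "ideal J (ring_on R)" and x: "x \<in> ipow J m"
  shows "y \<in> ipow J n \<Longrightarrow> x * y \<in> ipow J (m + n)"
proof (induction n arbitrary: y)
  case 0
  then show ?case using ideal_rmult[OF ideal_ipow[OF J] _ x] by simp
next
  case (Suc n)
  from Suc.prems[unfolded ipow_Suc] show ?case
  proof (induction rule: ideal_prod.induct)
    case (prod i j)
    have "(x * i) * j \<in> ipow J (Suc (m + n))"
      unfolding ipow_Suc using ideal_prod.prod[of "x * i" "ipow J (m + n)" j J "ring_on R"] Suc.IH prod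
      by simp
    then show ?case by (simp add: mult.assoc)
  next
    case (sum s1 s2)
    then show ?case
      using ideal_add[OF ideal_ipow[OF J]] by (simp add: distrib_left)
  qed
qed

lemma ipow_1: "ideal J (ring_on R) \<Longrightarrow> x \<in> J \<Longrightarrow> x \<in> ipow J 1"
  using ideal_prod.prod[of 1 "ipow J 0" x J "ring_on R"] by (simp add: ipow_Suc[of J 0, simplified])

lemma ipow_antimono:
  assumes J: "ideal J (ring_on R)" and "m \<le> n"
  shows "ipow J n \<subseteq> ipow J m"
  using \<open>m \<le> n\<close>
proof (induction rule: dec_induct)
  case (step n)
  have "ipow J (Suc n) \<subseteq> ipow J n"
    unfolding ipow_Suc using ring.ideal_prod_inter[OF ring_ring_on ideal_ipow[OF J] J] by blast
  then show ?case using step by blast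
qed simp

lemma ipow_power:
  assumes J: "ideal J (ring_on R)" and "x \<in> ipow J m"
  shows "x ^ n \<in> ipow J (m * n)"
proof (induction n)
  case (Suc n)
  then show ?case using ipow_mult[OF J assms(2) Suc.IH] by (simp add: algebra_simps)
qed simp

lemma ipow_prod:
  assumes J: "ideal J (ring_on R)" and "\<And>i. i \<in> A \<Longrightarrow> f i \<in> ipow J (e i)"
  shows "prod f A \<in> ipow J (sum e A)"
  using assms(2)
proof (induction A rule: infinite_finite_induct)
  case (insert x F)
  then show ?case using ipow_mult[OF J, of "f x" "e x" "prod f F" "sum e F"] by simp
qed auto

lemma ideal_Idl: "W \<subseteq> R \<Longrightarrow> ideal (genideal (ring_on R) W) (ring_on R)"
  using ring.genideal_ideal[OF ring_ring_on] by simp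

lemma Idl_incl: "W \<subseteq> R \<Longrightarrow> x \<in> W \<Longrightarrow> x \<in> genideal (ring_on R) W"
  using ring.genideal_self[OF ring_ring_on] by auto

lemma Idl_minimal: "ideal J (ring_on R) \<Longrightarrow> W \<subseteq> J \<Longrightarrow> genideal (ring_on R) W \<subseteq> J"
  using ring.genideal_minimal[OF ring_ring_on] by simp

end

section \<open>Symbolic powers by clearing denominators\<close>

locale proper_ideal = subdomain +
  fixes I assumes I: "ideal I (ring_on R)" and ex_min: "minimal_primes (ring_on R) I \<noteq> {}"
begin

definition S where "S = R - \<Union>(minimal_primes (ring_on R) I)"

lemma S_sub: "s \<in> S \<Longrightarrow> s \<in> R" by (simp add: S_def)

lemma min_primeD: "P \<in> minimal_primes (ring_on R) I \<Longrightarrow> primeideal P (ring_on R) \<and> I \<subseteq> P"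
  by (simp add: minimal_primes_def)

lemma S_one [simp]: "1 \<in> S"
  using min_primeD by (auto simp: S_def primeideal_ring_on_iff)

lemma S_mult: "s \<in> S \<Longrightarrow> s' \<in> S \<Longrightarrow> s * s' \<in> S"
  using min_primeD by (fastforce simp: S_def primeideal_ring_on_iff)

lemma S_power: "s \<in> S \<Longrightarrow> s ^ n \<in> S"
  by (induction n) (auto intro: S_mult)

text \<open>Every minimal prime contains \<open>I\<close>, and \<open>ex_min\<close> provides one.
  This keeps 0 out of \<open>S\<close>, so that fractions with denominators in \<open>S\<close>
  behave as in a localization.\<close>

lemma S_not_I: "s \<in> S \<Longrightarrow> s \<notin> I"
  using min_primeD ex_min by (auto simp: S_def)

lemma S_zero [simp]: "0 \<notin> S"
  using S_not_I ideal_0[OF I] by auto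

lemma subdomain_localization: "subdomain (localization R S)"
proof
  show "0 \<in> localization R S"
    using R_zero S_one unfolding localization_def Zero_fract_def by blast
  show "1 \<in> localization R S"
    using R_one S_one unfolding localization_def One_fract_def by blast
next
  fix x y assume "x \<in> localization R S" "y \<in> localization R S"
  then obtain a s b u where *: "x = Fract a s" "y = Fract b u" "a \<in> R" "b \<in> R" "s \<in> S" "u \<in> S"
    unfolding localization_def by blast
  then have "s \<noteq> 0" "u \<noteq> 0" by auto
  moreover have "a * u + b * s \<in> R" "a * b \<in> R" "s * u \<in> S" "- a \<in> R"
    using * by (simp_all add: S_sub R_add R_mult R_uminus S_mult)
  ultimately show "x + y \<in> localization R S" "x * y \<in> localization R S" "- x \<in> localization R S"
    using * unfolding localization_def by auto
qed

abbreviation sp where "sp \<equiv> symbolic_power R I"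

text \<open>The fractions with numerator in I^n and denominator in \<open>S\<close> already form an
  ideal of the localization, hence are the whole extension of I^n. Membership thus amounts to one
  multiplier from \<open>S\<close>, the form in which symbolic powers are used below.\<close>

lemma sp_iff: "f \<in> sp n \<longleftrightarrow> f \<in> R \<and> (\<exists>s\<in>S. s * f \<in> ipow I n)"
proof -
  interpret L: subdomain "localization R S" by (rule subdomain_localization)
  have idn: "ideal (ipow I n) (ring_on R)" by (rule ideal_ipow[OF I])
  have sub: "to_fract ` ipow I n \<subseteq> localization R S"
    using ideal_sub[OF idn] S_one unfolding localization_def to_fract_def by blast
  define W where "W = {Fract a s |a s. a \<in> ipow I n \<and> s \<in> S}"
  have "ideal W (ring_on (localization R S))"
    unfolding L.ideal_ring_on_iff
  proof (intro conjI ballI)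
    show "W \<subseteq> localization R S" using ideal_sub[OF idn] by (auto simp: W_def localization_def)
    show "0 \<in> W" using ideal_0[OF idn] S_one unfolding W_def Zero_fract_def by blast
  next
    fix x y assume "x \<in> W" "y \<in> W"
    then obtain a s b u where *: "x = Fract a s" "y = Fract b u" "a \<in> ipow I n" "b \<in> ipow I n" "s \<in> S" "u \<in> S"
      unfolding W_def by blast
    then have "s \<noteq> 0" "u \<noteq> 0" by auto
    with * show "x + y \<in> W"
      by (auto simp: W_def S_sub intro!: exI S_mult ideal_add[OF idn] ideal_rmult[OF idn])
  next
    fix x y assume "x \<in> localization R S" "y \<in> W"
    then obtain a s b u where *: "x = Fract a s" "y = Fract b u" "a \<in> R" "b \<in> ipow I n" "s \<in> S" "u \<in> S"
      unfolding W_def localization_def by blast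
    then have "s \<noteq> 0" "u \<noteq> 0" by auto
    with * show "x * y \<in> W"
      by (auto simp: W_def S_sub intro!: exI S_mult ideal_lmult[OF idn])
  qed
  moreover have "to_fract ` ipow I n \<subseteq> W" using S_one unfolding W_def to_fract_def by blast
  ultimately have IX: "genideal (ring_on (localization R S)) (to_fract ` ipow I n) \<subseteq> W"
    by (rule L.Idl_minimal)
  have XI: "to_fract f \<in> genideal (ring_on (localization R S)) (to_fract ` ipow I n)" if "s \<in> S" "s * f \<in> ipow I n" for s
  proof -
    have "Fract 1 s \<in> localization R S" using that by (auto simp: localization_def)
    moreover have "to_fract (s * f) \<in> genideal (ring_on (localization R S)) (to_fract ` ipow I n)"
      using L.Idl_incl[OF sub] that by blast
    ultimately have "Fract 1 s * to_fract (s * f) \<in> genideal (ring_on (localization R S)) (to_fract ` ipow I n)"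
      by (rule L.ideal_lmult[OF L.ideal_Idl[OF sub]])
    moreover have "s \<noteq> 0" using that by auto
    then have "Fract 1 s * to_fract (s * f) = to_fract f" by (simp add: to_fract_def eq_fract)
    ultimately show ?thesis by (simp only:)
  qed
  have "\<exists>s\<in>S. s * f \<in> ipow I n" if "to_fract f \<in> W"
  proof -
    from that obtain a s where *: "to_fract f = Fract a s" "a \<in> ipow I n" "s \<in> S" by (auto simp: W_def)
    then have "s \<noteq> 0" by auto
    then have "s * f = a" using * by (simp add: to_fract_def eq_fract mult.commute)
    then show ?thesis using * by blast
  qed
  then show ?thesis
    using IX XI unfolding symbolic_power_def Let_def S_def[symmetric] ipow_def[symmetric] by blast
qed

lemma sp_0 [simp]: "sp 0 = R"
  by (auto simp: sp_iff S_sub intro!: bexI[of _ 1])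

lemma sp_sub: "f \<in> sp n \<Longrightarrow> f \<in> R" by (simp add: sp_iff)

lemma ipow_sp: "f \<in> ipow I n \<Longrightarrow> f \<in> sp n"
  using ideal_sub[OF ideal_ipow[OF I]] by (auto simp: sp_iff intro!: bexI[of _ 1])

lemma sp_mult: "f \<in> sp m \<Longrightarrow> g \<in> sp n \<Longrightarrow> f * g \<in> sp (m + n)"
proof -
  assume "f \<in> sp m" "g \<in> sp n"
  then obtain s u where *: "f \<in> R" "g \<in> R" "s \<in> S" "u \<in> S" "s * f \<in> ipow I m" "u * g \<in> ipow I n"
    unfolding sp_iff by blast
  then have "(s * u) * (f * g) \<in> ipow I (m + n)"
    using ipow_mult[OF I, of "s * f" m "u * g" n] by (simp add: algebra_simps)
  then show ?thesis using * S_mult unfolding sp_iff by blast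
qed

lemma ideal_sp: "ideal (sp n) (ring_on R)"
  unfolding ideal_ring_on_iff
proof (intro conjI ballI)
  fix x y assume "x \<in> sp n" "y \<in> sp n"
  then obtain s u where *: "x \<in> R" "y \<in> R" "s \<in> S" "u \<in> S" "s * x \<in> ipow I n" "u * y \<in> ipow I n"
    unfolding sp_iff by blast
  have "u * (s * x) \<in> ipow I n" "s * (u * y) \<in> ipow I n"
    using ideal_lmult[OF ideal_ipow[OF I] S_sub] * by blast+
  then have "u * (s * x) + s * (u * y) \<in> ipow I n"
    by (rule ideal_add[OF ideal_ipow[OF I]])
  then have "(s * u) * (x + y) \<in> ipow I n" by (simp add: algebra_simps)
  then show "x + y \<in> sp n" using * S_mult unfolding sp_iff by blast
next
  fix a x assume "a \<in> R" "x \<in> sp n"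
  then show "a * x \<in> sp n" using sp_mult[of a 0 x n] by simp
qed (use sp_sub ipow_sp ideal_0[OF ideal_ipow[OF I]] in auto)

lemma sp_antimono: "m \<le> n \<Longrightarrow> sp n \<subseteq> sp m"
  using ipow_antimono[OF I] by (fastforce simp: sp_iff)

lemma one_notin_sp: "n > 0 \<Longrightarrow> 1 \<notin> sp n"
proof
  assume "n > 0" "1 \<in> sp n"
  then have "1 \<in> sp (Suc 0)" using sp_antimono[of "Suc 0" n] by auto
  then obtain s where s: "s \<in> S" "s \<in> ipow I 1" by (auto simp: sp_iff)
  moreover have "ipow I 1 \<subseteq> I"
    unfolding One_nat_def ipow_Suc
    using ring.ideal_prod_inter[OF ring_ring_on ideal_ipow[OF I, of 0] I] by auto
  ultimately show False using S_not_I by auto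
qed

end

subsection \<open>Splittings of the Rees algebra and the associated graded ring\<close>

lemma CHAR_eqI:
  assumes "prime p" and "of_nat p = (0 :: 'b :: semiring_1)"
  shows "CHAR('b) = p"
proof -
  have "CHAR('b) dvd p" using assms(2) of_nat_eq_0_iff_char_dvd by blast
  moreover have "CHAR('b) \<noteq> 1"
    using of_nat_CHAR[where 'a = 'b] by (metis of_nat_1 zero_neq_one)
  ultimately show ?thesis using assms(1) by (auto simp: prime_nat_iff)
qed

text \<open>Ring laws pass to a homomorphic image. They are obtained in this way for the associated
  graded ring, an image of the Rees algebra, without computing with its product over all
  representatives.\<close>

lemma cring_image:
  assumes "cring A" and img: "h ` carrier A = carrier B"
    and mult: "\<And>x y. x \<in> carrier A \<Longrightarrow> y \<in> carrier A \<Longrightarrow> h (x \<otimes>\<^bsub>A\<^esub> y) = h x \<otimes>\<^bsub>B\<^esub> h y"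
    and add: "\<And>x y. x \<in> carrier A \<Longrightarrow> y \<in> carrier A \<Longrightarrow> h (x \<oplus>\<^bsub>A\<^esub> y) = h x \<oplus>\<^bsub>B\<^esub> h y"
    and one: "h \<one>\<^bsub>A\<^esub> = \<one>\<^bsub>B\<^esub>" and zero: "h \<zero>\<^bsub>A\<^esub> = \<zero>\<^bsub>B\<^esub>"
  shows "cring B"
proof -
  interpret A: cring A by fact
  have car: "h x \<in> carrier B" if "x \<in> carrier A" for x using that img by auto
  have ex: "\<exists>x'\<in>carrier A. x = h x'" if "x \<in> carrier B" for x using that img by auto
  note simps = mult[symmetric] add[symmetric] one[symmetric] zero[symmetric]
  show ?thesis
  proof (rule cringI)
    show "abelian_group B"
    proof (rule abelian_groupI)
      fix x assume "x \<in> carrier B"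
      then obtain x' where "x' \<in> carrier A" "x = h x'" using ex by blast
      then show "\<exists>y\<in>carrier B. y \<oplus>\<^bsub>B\<^esub> x = \<zero>\<^bsub>B\<^esub>"
        by (intro bexI[of _ "h (\<ominus>\<^bsub>A\<^esub> x')"]) (simp_all add: simps car A.l_neg)
    qed (auto dest!: ex simp: simps car A.a_assoc intro: A.a_comm[THEN arg_cong])
    show "Group.comm_monoid B"
      by (rule comm_monoidI) (auto dest!: ex simp: simps car A.m_assoc intro: A.m_comm[THEN arg_cong])
  qed (auto dest!: ex simp: simps car A.l_distr)
qed

lemma coeff_one: "coeff 1 n = (if n = 0 then 1 else 0)"
  by (simp add: one_poly_eq_simps(1)[symmetric] coeff_pCons split: nat.split)

text \<open>A map \<phi> on R^(1/p) is encoded by \<phi>(x) = T(x^p): then \<open>T\<close> goes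
  from \<open>R\<close> to \<open>R\<close>, and no roots occur. All three conclusions of the
  theorem are derived from these assumptions.\<close>

locale frobenius_section = proper_ideal +
  fixes p :: nat and T :: "'a \<Rightarrow> 'a"
  assumes p: "prime p" and CHAR: "CHAR('a) = p"
    and T_R [intro]: "x \<in> R \<Longrightarrow> T x \<in> R"
    and T_add: "x \<in> R \<Longrightarrow> y \<in> R \<Longrightarrow> T (x + y) = T x + T y"
    and T_lin: "a \<in> R \<Longrightarrow> x \<in> R \<Longrightarrow> T (a ^ p * x) = a * T x"
    and T_one: "T 1 = 1"
    and T_sp: "x \<in> sp (n * p + 1) \<Longrightarrow> T x \<in> sp (n + 1)"
begin

lemma p_pos [simp]: "p > 0" using p prime_gt_0_nat by blast

lemma T_0 [simp]: "T 0 = 0" using T_add[of 0 0] by (metis R_zero add.right_neutral add_left_cancel)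

lemma T_uminus: "x \<in> R \<Longrightarrow> T (- x) = - T x"
  using T_add[of x "- x"] by (simp add: R_uminus eq_neg_iff_add_eq_0 add.commute)

lemma T_diff: "x \<in> R \<Longrightarrow> y \<in> R \<Longrightarrow> T (x - y) = T x - T y"
  using T_add[of x "- y"] by (simp add: R_uminus T_uminus)

lemma T_sum: "(\<And>i. i \<in> A \<Longrightarrow> f i \<in> R) \<Longrightarrow> T (sum f A) = (\<Sum>i\<in>A. T (f i))"
  by (induction A rule: infinite_finite_induct) (auto simp: T_add R_sum)

lemma T_power: "a \<in> R \<Longrightarrow> T (a ^ p) = a"
  using T_lin[of a 1] T_one by simp

text \<open>For n = m + 1 one has n p \<ge> m p + 1, so this is a weaker form of
  \<open>T_sp\<close>; for n = 0 it says that \<open>T\<close> maps \<open>R\<close> to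
  \<open>R\<close>. It serves the Rees algebra, while the associated graded ring needs
  \<open>T_sp\<close> itself.\<close>

lemma T_sp': "x \<in> sp (n * p) \<Longrightarrow> T x \<in> sp n"
proof (cases n)
  case (Suc m)
  assume "x \<in> sp (n * p)"
  moreover have "m * p + 1 \<le> n * p" using Suc p_pos by (simp add: Suc_le_eq)
  ultimately have "x \<in> sp (m * p + 1)" using sp_antimono by blast
  then show ?thesis using T_sp[of x m] Suc by simp
qed auto

section \<open>The splitting of R in R^(1/p)\<close>

lemma inj_emb: "emb x = emb y \<longleftrightarrow> x = (y :: 'a)"
  by (simp add: emb_def)

lemma emb_hom: "emb (x + y) = emb x + emb y" "emb (x * y) = emb x * emb (y :: 'a)"
    "emb (0 :: 'a) = 0" "emb (1 :: 'a) = 1"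
  by (simp_all add: emb_def)

lemma emb_power: "emb (x ^ n) = emb (x :: 'a) ^ n"
  by (induction n) (simp_all add: emb_hom)

lemma emb_of_nat: "emb (of_nat n :: 'a) = of_nat n"
  by (induction n) (simp_all add: emb_hom)

lemma CHAR_closure: "CHAR('a fract alg_closure) = p"
proof (rule CHAR_eqI[OF p])
  have "of_nat p = (0 :: 'a)" using CHAR of_nat_CHAR by metis
  then show "of_nat p = (0 :: 'a fract alg_closure)"
    using emb_of_nat[of p] by (simp add: emb_hom)
qed

theorem symbolic_F_split: "symbolic_F_split p R I"
proof -
  \<comment> \<open>\<open>g\<close> is x |-> x^p from R^(1/p) to \<open>R\<close>, well defined
    because \<open>emb\<close> is injective. The required map is \<open>T\<close> after
    \<open>g\<close>.\<close>
  define g where "g x = (THE y. emb y = x ^ p)" for x :: "'a fract alg_closure"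
  have g_eq: "g x = y" if "emb y = x ^ p" for x y
    unfolding g_def using that by (intro the_equality) (auto simp flip: inj_emb)
  have g: "g x \<in> J" "emb (g x) = x ^ p" if "x \<in> proots p J" for x J
    using that g_eq unfolding proots_def by auto
  have g_add: "g (x + y) = g x + g y" if "x \<in> proots p R" "y \<in> proots p R" for x y
    proof -
    have "(x + y) ^ p = x ^ p + y ^ p"
      by (rule freshmans_dream) (use CHAR_closure p in simp_all)
    then show ?thesis using that g by (intro g_eq) (simp add: emb_hom)
  qed
  have g_mult: "g (emb a * x) = a ^ p * g x" if "x \<in> proots p R" for a x
    using that g by (intro g_eq) (simp add: emb_hom emb_power power_mult_distrib)
  have g_emb: "g (emb a) = a ^ p" for a by (intro g_eq) (simp add: emb_power)
  show ?thesis
    unfolding symbolic_F_split_def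
  proof (intro bexI[of _ "\<lambda>x. T (g x)"] conjI ballI allI)
    show "(\<lambda>x. T (g x)) ` proots p (sp (n * p + 1)) \<subseteq> sp (n + 1)" for n
      using g(1) T_sp by blast
  qed (use g(1) in \<open>auto simp: g_add g_mult g_emb T_add T_lin T_power\<close>)
qed

section \<open>The symbolic Rees algebra\<close>

definition rees where "rees = {f :: 'a poly. \<forall>n. coeff f n \<in> sp n}"

lemma subdomain_rees: "subdomain rees"
proof
  fix x y assume "x \<in> rees" "y \<in> rees"
  show "x * y \<in> rees"
    unfolding rees_def coeff_mult mem_Collect_eq
  proof (intro allI ideal_sum[OF ideal_sp])
    fix n i :: nat assume "i \<in> {..n}"
    then show "coeff x i * coeff y (n - i) \<in> sp n"
      using \<open>x \<in> rees\<close> \<open>y \<in> rees\<close> sp_mult[of "coeff x i" i "coeff y (n - i)" "n - i"]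
      by (simp add: rees_def)
  qed
qed (auto simp: rees_def ideal_0[OF ideal_sp] ideal_add[OF ideal_sp] ideal_uminus[OF ideal_sp] coeff_one
    simp flip: One_nat_def)

sublocale rees: subdomain rees by (rule subdomain_rees)

text \<open>Degrees not divisible by \<open>p\<close> are discarded, and degree n p moves to degree
  n with \<open>T\<close> applied to the coefficient. The summation bound is large enough since n
  \<le> n p.\<close>

definition \<Phi> :: "'a poly \<Rightarrow> 'a poly" where
  "\<Phi> f = (\<Sum>n\<le>degree f. monom (T (coeff f (n * p))) n)"

lemma coeff_\<Phi>: "coeff (\<Phi> f) n = T (coeff f (n * p))"
proof -
  have "coeff f (n * p) = 0" if "\<not> n \<le> degree f"
  proof (rule coeff_eq_0)
    have "n \<le> n * p" using p_pos by (simp add: Suc_le_eq)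
    then show "degree f < n * p" using that by linarith
  qed
  then show ?thesis by (auto simp: \<Phi>_def coeff_sum sum.delta if_distrib cong: if_cong)
qed

lemma rees_R: "f \<in> rees \<Longrightarrow> coeff f n \<in> R"
  using sp_sub by (auto simp: rees_def)

lemma \<Phi>_rees: "f \<in> rees \<Longrightarrow> \<Phi> f \<in> rees"
  by (auto simp: rees_def coeff_\<Phi> intro: T_sp')

lemma \<Phi>_add: "f \<in> rees \<Longrightarrow> g \<in> rees \<Longrightarrow> \<Phi> (f + g) = \<Phi> f + \<Phi> g"
  by (simp add: poly_eq_iff coeff_\<Phi> T_add rees_R)

lemma poly_power_p: "(a :: 'a poly) ^ p = (\<Sum>i\<le>degree a. monom (coeff a i ^ p) (i * p))"
proof -
  have "a ^ p = (\<Sum>i\<le>degree a. monom (coeff a i) i) ^ p"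
    by (simp add: poly_as_sum_of_monoms)
  also have "\<dots> = (\<Sum>i\<le>degree a. monom (coeff a i) i ^ p)"
    by (rule freshmans_dream_sum) (simp_all add: CHAR p)
  finally show ?thesis by (simp add: monom_power mult.commute)
qed

text \<open>By additivity of the Frobenius, \<open>a ^ p\<close> is the sum of the p-th powers of
  the terms of \<open>a\<close>, which sit in degrees i p. Such a term shifts degree (n - i) p to n
  p, so \<open>T_lin\<close> applies to each summand.\<close>

lemma \<Phi>_lin:
  assumes a: "a \<in> rees" and f: "f \<in> rees"
  shows "\<Phi> (a ^ p * f) = a * \<Phi> f"
proof (rule poly_eqI)
  fix n
  have R: "coeff a i \<in> R" "coeff f i \<in> R" for i using a f rees_R by auto
  have "coeff (\<Phi> (a ^ p * f)) n = T (\<Sum>i\<le>degree a. coeff (monom (coeff a i ^ p) (i * p) * f) (n * p))"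
    by (simp add: coeff_\<Phi> poly_power_p sum_distrib_right coeff_sum)
  also have "\<dots> = (\<Sum>i\<le>degree a. T (coeff (monom (coeff a i ^ p) (i * p) * f) (n * p)))"
    by (rule T_sum) (auto simp: coeff_monom_mult R R_mult R_power)
  also have "\<dots> = (\<Sum>i\<le>degree a. coeff (monom (coeff a i) i * \<Phi> f) n)"
    by (rule sum.cong) (auto simp: coeff_monom_mult coeff_\<Phi> R T_lin diff_mult_distrib)
  also have "\<dots> = coeff (a * \<Phi> f) n"
    by (simp add: poly_as_sum_of_monoms flip: coeff_sum sum_distrib_right)
  finally show "coeff (\<Phi> (a ^ p * f)) n = coeff (a * \<Phi> f) n" .
qed

lemma \<Phi>_power: "a \<in> rees \<Longrightarrow> \<Phi> (a ^ p) = a"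
proof -
  have "\<Phi> 1 = 1" by (rule poly_eqI) (auto simp: coeff_\<Phi> coeff_one T_one p_pos[THEN gr_implies_not0])
  then show "a \<in> rees \<Longrightarrow> \<Phi> (a ^ p) = a" using \<Phi>_lin[of a 1] rees.R_one by simp
qed

theorem F_split_Rees: "F_split p (symbolic_Rees R I)"
proof -
  have "symbolic_Rees R I = ring_on rees" by (simp add: symbolic_Rees_def rees_def)
  moreover have "F_split p (ring_on rees)"
    unfolding F_split_def has_characteristic_def
  proof (intro conjI allI bexI[of _ \<Phi>] ballI rees.cring_ring_on)
    show "add_pow (ring_on rees) n \<one>\<^bsub>ring_on rees\<^esub> = \<zero>\<^bsub>ring_on rees\<^esub> \<longleftrightarrow> p dvd n" for n :: nat
      by (simp add: of_nat_eq_0_iff_char_dvd CHAR)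
  qed (auto simp: \<Phi>_add \<Phi>_lin \<Phi>_power \<Phi>_rees)
  ultimately show ?thesis by simp
qed

section \<open>The associated graded ring\<close>

definition cls where "cls n x = sp (Suc n) +>\<^bsub>ring_on R\<^esub> x"

lemma cls_mem: "y \<in> cls n x \<longleftrightarrow> y - x \<in> sp (Suc n)"
  by (auto simp: cls_def a_r_coset_def r_coset_def intro!: bexI[of _ "y - x"])

lemma cls_eq_iff: "cls n x = cls n y \<longleftrightarrow> x - y \<in> sp (Suc n)"
proof
  assume "cls n x = cls n y"
  moreover have "x \<in> cls n x" using ideal_0[OF ideal_sp] by (simp add: cls_mem)
  ultimately show "x - y \<in> sp (Suc n)" by (simp add: cls_mem)
next
  assume *: "x - y \<in> sp (Suc n)"
  have "z - x \<in> sp (Suc n) \<longleftrightarrow> z - y \<in> sp (Suc n)" for z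
    using ideal_add[OF ideal_sp _ *, of "z - x"] ideal_diff[OF ideal_sp _ *, of "z - y"] by auto
  then show "cls n x = cls n y" by (auto simp: cls_mem)
qed

lemma cls_add: "cls n x <+>\<^bsub>ring_on R\<^esub> cls n y = cls n (x + y)"
proof (intro Set.set_eqI iffI)
  fix z assume "z \<in> cls n x <+>\<^bsub>ring_on R\<^esub> cls n y"
  then obtain u v where "u - x \<in> sp (Suc n)" "v - y \<in> sp (Suc n)" "z = u + v"
    by (auto simp: set_add_def set_mult_def cls_mem)
  then show "z \<in> cls n (x + y)"
    using ideal_add[OF ideal_sp, of "u - x" "Suc n" "v - y"] by (simp add: cls_mem algebra_simps)
next
  fix z assume "z \<in> cls n (x + y)"
  then have "x \<in> cls n x" "z - x \<in> cls n y"
    using ideal_0[OF ideal_sp] by (auto simp: cls_mem algebra_simps)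
  then show "z \<in> cls n x <+>\<^bsub>ring_on R\<^esub> cls n y"
    by (force simp: set_add_def set_mult_def)
qed

abbreviation gr where "gr \<equiv> symbolic_gr R I"

lemma gr_simps:
  "carrier gr = {G. (\<forall>n. G n \<in> cls n ` sp n) \<and> finite {n. G n \<noteq> cls n 0}}"
  "G \<otimes>\<^bsub>gr\<^esub> H = (\<lambda>n. \<Union>{cls n (\<Sum>i\<le>n. a i * b (n - i)) |a b.
                              (\<forall>i. a i \<in> G i) \<and> (\<forall>i. b i \<in> H i)})"
  "\<one>\<^bsub>gr\<^esub> = (\<lambda>n. cls n (if n = 0 then 1 else 0))"
  "\<zero>\<^bsub>gr\<^esub> = (\<lambda>n. cls n 0)"
  "G \<oplus>\<^bsub>gr\<^esub> H = (\<lambda>n. G n <+>\<^bsub>ring_on R\<^esub> H n)"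
  by (simp_all add: symbolic_gr_def Let_def cls_def)

definition \<pi> where "\<pi> f = (\<lambda>n. cls n (coeff f n))"

lemma \<pi>_eq_iff: "\<pi> f = \<pi> g \<longleftrightarrow> (\<forall>n. coeff (f - g) n \<in> sp (Suc n))"
  by (auto simp: \<pi>_def fun_eq_iff cls_eq_iff)

lemma \<pi>_image: "\<pi> ` rees = carrier gr"
proof (intro Set.set_eqI iffI)
  fix G assume "G \<in> \<pi> ` rees"
  then obtain f where f: "f \<in> rees" "G = \<pi> f" by blast
  have "{n. cls n (coeff f n) \<noteq> cls n 0} \<subseteq> {..degree f}"
    by (clarsimp, rule ccontr) (simp add: coeff_eq_0)
  then have "finite {n. cls n (coeff f n) \<noteq> cls n 0}" by (rule finite_subset) simp
  then show "G \<in> carrier gr" using f by (auto simp: gr_simps \<pi>_def rees_def)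
next
  fix G assume G: "G \<in> carrier gr"
  \<comment> \<open>A zero class gets the representative 0, so that the finite support of
    \<open>G\<close> makes \<open>c\<close> the coefficient sequence of a polynomial.\<close>
  define c where "c n = (if G n = cls n 0 then 0 else SOME x. x \<in> sp n \<and> G n = cls n x)" for n
  have c: "c n \<in> sp n \<and> G n = cls n (c n)" for n
  proof (cases "G n = cls n 0")
    case False
    have "\<exists>x. x \<in> sp n \<and> G n = cls n x" using G by (auto simp: gr_simps)
    from someI_ex[OF this] show ?thesis using False by (simp add: c_def)
  qed (simp add: c_def ideal_0[OF ideal_sp])
  have "finite {n. c n \<noteq> 0}"
    by (rule finite_subset[of _ "{n. G n \<noteq> cls n 0}"]) (use G in \<open>auto simp: c_def gr_simps\<close>)
  then have "coeff (Abs_poly c) = c"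
    by (intro Abs_poly_inverse) (simp add: MOST_iff_cofinite eventually_cofinite)
  then show "G \<in> \<pi> ` rees"
    using c by (intro image_eqI[of _ _ "Abs_poly c"]) (auto simp: \<pi>_def rees_def fun_eq_iff)
qed

text \<open>All choices of representatives give one class: replacing f by a and g by b in a product
  changes it by (a - f) b + f (b - g), which has symbolic order one higher. The union in the product
  of \<open>gr\<close> is therefore over a single coset.\<close>

lemma \<pi>_mult:
  assumes "f \<in> rees" "g \<in> rees"
  shows "\<pi> (f * g) = \<pi> f \<otimes>\<^bsub>gr\<^esub> \<pi> g"
proof
  fix n
  have *: "cls n (\<Sum>i\<le>n. a i * b (n - i)) = cls n (coeff (f * g) n)"
    if "\<forall>i. a i \<in> cls i (coeff f i)" "\<forall>i. b i \<in> cls i (coeff g i)" for a b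
  proof -
    have "a i * b (n - i) - coeff f i * coeff g (n - i) \<in> sp (Suc n)" if "i \<le> n" for i
    proof -
      have 1: "a i - coeff f i \<in> sp (Suc i)" and 2: "b (n - i) - coeff g (n - i) \<in> sp (Suc (n - i))"
        using \<open>\<forall>i. a i \<in> _\<close> \<open>\<forall>i. b i \<in> _\<close> by (auto simp: cls_mem)
      have 3: "coeff f i \<in> sp i" "coeff g (n - i) \<in> sp (n - i)" using assms by (auto simp: rees_def)
      have 4: "b (n - i) \<in> sp (n - i)"
        using ideal_add[OF ideal_sp 3(2), of "b (n - i) - coeff g (n - i)"] 2 sp_antimono[of "n - i" "Suc (n - i)"] by auto
      have "(a i - coeff f i) * b (n - i) \<in> sp (Suc n)" "coeff f i * (b (n - i) - coeff g (n - i)) \<in> sp (Suc n)"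
        using sp_mult[OF 1 4] sp_mult[OF 3(1) 2] that by simp_all
      then show ?thesis
        using ideal_add[OF ideal_sp] by (fastforce simp: algebra_simps)
    qed
    then have "(\<Sum>i\<le>n. a i * b (n - i) - coeff f i * coeff g (n - i)) \<in> sp (Suc n)"
      by (intro ideal_sum[OF ideal_sp]) auto
    then show ?thesis by (simp add: cls_eq_iff coeff_mult sum_subtractf)
  qed
  have "coeff f i \<in> cls i (coeff f i)" "coeff g i \<in> cls i (coeff g i)" for i
    using ideal_0[OF ideal_sp] by (auto simp: cls_mem)
  then have "cls n (coeff (f * g) n) \<in> {cls n (\<Sum>i\<le>n. a i * b (n - i)) |a b.
      (\<forall>i. a i \<in> cls i (coeff f i)) \<and> (\<forall>i. b i \<in> cls i (coeff g i))}"
    unfolding coeff_mult by blast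
  then have "{cls n (\<Sum>i\<le>n. a i * b (n - i)) |a b.
      (\<forall>i. a i \<in> cls i (coeff f i)) \<and> (\<forall>i. b i \<in> cls i (coeff g i))} = {cls n (coeff (f * g) n)}"
    using * by blast
  then show "\<pi> (f * g) n = (\<pi> f \<otimes>\<^bsub>gr\<^esub> \<pi> g) n"
    by (simp add: gr_simps \<pi>_def)
qed

lemma \<pi>_add: "\<pi> (f + g) = \<pi> f \<oplus>\<^bsub>gr\<^esub> \<pi> g"
  by (simp add: gr_simps \<pi>_def cls_add)

lemma \<pi>_one: "\<pi> 1 = \<one>\<^bsub>gr\<^esub>" and \<pi>_zero: "\<pi> 0 = \<zero>\<^bsub>gr\<^esub>"
  by (simp_all add: gr_simps \<pi>_def fun_eq_iff coeff_one)

lemma cring_gr: "cring gr"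
  by (rule cring_image[OF rees.cring_ring_on, of \<pi>])
    (simp_all add: \<pi>_image \<pi>_mult \<pi>_add \<pi>_one \<pi>_zero)

lemma \<pi>_power: "f \<in> rees \<Longrightarrow> \<pi> f [^]\<^bsub>gr\<^esub> (n::nat) = \<pi> (f ^ n)"
proof (induction n)
  case (Suc n)
  then show ?case using \<pi>_mult[of "f ^ n" f] by (simp add: nat_pow_def rees.R_power mult.commute)
qed (simp add: nat_pow_def \<pi>_one)

lemma \<pi>_of_nat: "add_pow gr (n::nat) \<one>\<^bsub>gr\<^esub> = \<pi> (of_nat n)"
proof (induction n)
  case (Suc n)
  then show ?case
    using \<pi>_add[of "of_nat n" 1]
    by (simp add: add_pow_def nat_pow_def \<pi>_one add.commute)
qed (simp add: add_pow_def nat_pow_def \<pi>_zero)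

text \<open>If \<open>p\<close> does not divide n, Bezout makes n invertible modulo
  \<open>p\<close>, and n in I^(1) would put 1 there. This gives the characteristic of the degree 0
  part of \<open>gr\<close>.\<close>

lemma of_nat_sp: "of_nat n \<in> sp (Suc 0) \<longleftrightarrow> p dvd n"
proof
  assume *: "of_nat n \<in> sp (Suc 0)"
  show "p dvd n"
  proof (rule ccontr)
    assume "\<not> p dvd n"
    then have "coprime p n" using p by (simp add: prime_imp_coprime)
    then have "gcd n p = 1" by (simp add: coprime_iff_gcd_eq_1 gcd.commute)
    moreover have "n \<noteq> 0" using \<open>\<not> p dvd n\<close> by (cases n) auto
    ultimately obtain u v where "n * u = p * v + 1" using bezout_nat[of n p] by auto
    then have "of_nat (n * u) = (of_nat (p * v + 1) :: 'a)" by simp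
    then have "of_nat (n * u) = (1 :: 'a)" using CHAR of_nat_CHAR[where 'a = 'a] by simp
    moreover have "of_nat u * of_nat n \<in> sp (Suc 0)"
      by (rule ideal_lmult[OF ideal_sp _ *]) (induction u, auto)
    ultimately show False using one_notin_sp[of "Suc 0"] by (simp add: mult.commute)
  qed
next
  assume "p dvd n"
  then show "of_nat n \<in> sp (Suc 0)"
    using ideal_0[OF ideal_sp] CHAR by (metis of_nat_eq_0_iff_char_dvd)
qed

theorem F_split_gr: "F_split p gr"
proof -
  \<comment> \<open>\<open>\<Psi>\<close> is induced by \<open>\<Phi>\<close>, computed on an
    arbitrary lift. Two lifts differ in degree n p by an element of I^(np+1), which
    \<open>T_sp\<close> sends into I^(n+1); hence the choice does not affect the class.\<close>
  define \<Psi> where "\<Psi> x = \<pi> (\<Phi> (SOME f. f \<in> rees \<and> \<pi> f = x))" for x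
  have \<Psi>: "\<Psi> (\<pi> f) = \<pi> (\<Phi> f)" if f: "f \<in> rees" for f
  proof -
    define g where "g = (SOME g. g \<in> rees \<and> \<pi> g = \<pi> f)"
    have g: "g \<in> rees" "\<pi> g = \<pi> f"
      using someI[of "\<lambda>g. g \<in> rees \<and> \<pi> g = \<pi> f" f] f by (auto simp: g_def)
    have "coeff (\<Phi> g - \<Phi> f) n \<in> sp (Suc n)" for n
      using T_sp[of "coeff (g - f) (n * p)" n] g(2) rees_R[OF f] rees_R[OF g(1)]
      by (simp add: coeff_\<Phi> T_diff \<pi>_eq_iff)
    then have "\<pi> (\<Phi> g) = \<pi> (\<Phi> f)" unfolding \<pi>_eq_iff by blast
    then show ?thesis by (simp only: \<Psi>_def g_def)
  qed
  have ex: "\<exists>f\<in>rees. x = \<pi> f" if "x \<in> carrier gr" for x using that \<pi>_image by blast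
  have car: "\<pi> f \<in> carrier gr" if "f \<in> rees" for f using that \<pi>_image by blast
  show ?thesis
    unfolding F_split_def has_characteristic_def
  proof (intro conjI cring_gr allI bexI[of _ \<Psi>] ballI)
    show "add_pow gr n \<one>\<^bsub>gr\<^esub> = \<zero>\<^bsub>gr\<^esub> \<longleftrightarrow> p dvd n" for n :: nat
      using of_nat_sp[of n] ideal_0[OF ideal_sp]
      by (auto simp: \<pi>_of_nat simp flip: \<pi>_zero)
        (auto simp: \<pi>_eq_iff of_nat_poly coeff_pCons split: nat.splits)
  qed (auto dest!: ex simp: \<Psi> \<Phi>_rees car \<pi>_power \<Phi>_add \<Phi>_lin \<Phi>_power rees.R_add rees.R_mult rees.R_power
      simp flip: \<pi>_add \<pi>_mult)
qed

end

subsection \<open>Evaluation and traces of polynomials\<close>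

lemma single_induct [case_names zero single add]:
  assumes "P 0" and "\<And>m a. P (Poly_Mapping.single m a)" and "\<And>f g. P f \<Longrightarrow> P g \<Longrightarrow> P (f + g)"
  shows "P (f :: 'b \<Rightarrow>\<^sub>0 'c :: monoid_add)"
proof (induction f rule: update_induct)
  case (update f a b)
  have "Poly_Mapping.update a b f = f + Poly_Mapping.single a b"
    using update by (intro poly_mapping_eqI) (auto simp: lookup_update lookup_add lookup_single when_def in_keys_iff)
  then show ?case using update assms by simp
qed (rule assms)

definition power_prod :: "('v \<Rightarrow> 'b::comm_monoid_mult) \<Rightarrow> ('v \<Rightarrow>\<^sub>0 nat) \<Rightarrow> 'b" where
  "power_prod x m = (\<Prod>v\<in>Poly_Mapping.keys m. x v ^ Poly_Mapping.lookup m v)"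

lemma power_prod_superset:
  assumes "finite A" "Poly_Mapping.keys m \<subseteq> A"
  shows "power_prod x m = (\<Prod>v\<in>A. x v ^ Poly_Mapping.lookup m v)"
  unfolding power_prod_def using assms by (intro prod.mono_neutral_left) (auto simp: in_keys_iff)

lemma power_prod_add: "power_prod x (m + n) = power_prod x m * power_prod x n"
proof -
  let ?A = "Poly_Mapping.keys m \<union> Poly_Mapping.keys n"
  have "power_prod x k = (\<Prod>v\<in>?A. x v ^ Poly_Mapping.lookup k v)" if "k \<in> {m, n, m + n}" for k
    using that keys_add[of m n] by (intro power_prod_superset) auto
  then show ?thesis by (simp add: lookup_add power_add prod.distrib)
qed

lemma power_prod_0 [simp]: "power_prod x 0 = 1"
  by (simp add: power_prod_def)

lemma power_prod_single [simp]: "power_prod x (Poly_Mapping.single v n) = x v ^ n"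
  by (simp add: power_prod_def)

definition ev :: "('k::comm_ring_1 \<Rightarrow> 'b::comm_ring_1) \<Rightarrow> ('v \<Rightarrow> 'b) \<Rightarrow> (('v \<Rightarrow>\<^sub>0 nat) \<Rightarrow>\<^sub>0 'k) \<Rightarrow> 'b" where
  "ev c x f = (\<Sum>m\<in>Poly_Mapping.keys f. c (Poly_Mapping.lookup f m) * power_prod x m)"

context comm_ring_hom begin

lemma ev_add: "ev hom x (f + g) = ev hom x f + ev hom x g"
  unfolding ev_def by (rule setsum_keys_plus_distrib) (simp_all add: hom_add distrib_right)

lemma ev_single: "ev hom x (Poly_Mapping.single m a) = hom a * power_prod x m"
  by (simp add: ev_def)

lemma ev_0: "ev hom x 0 = 0"
  by (simp add: ev_def)

lemma ev_1: "ev hom x 1 = 1"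
  by (simp add: ev_single flip: single_one)

lemma ev_mult: "ev hom x (f * g) = ev hom x f * ev hom x g"
proof (induction f rule: single_induct)
  case (single m a)
  show ?case
    by (induction g rule: single_induct)
      (simp_all add: ev_0 ev_single ev_add mult_single power_prod_add hom_mult distrib_left distrib_right mult_ac)
qed (simp_all add: ev_0 ev_add distrib_right)

lemma ev_hom: "comm_ring_hom (ev hom x)"
  by unfold_locales (simp_all add: ev_0 ev_1 ev_add ev_mult)

end

lemma ev_indet:
  assumes "comm_ring_hom c"
  shows "ev c x (indet v) = x v"
proof -
  interpret comm_ring_hom c by fact
  show ?thesis by (simp add: indet_def ev_single)
qed

lemma (in comm_ring_hom) hom_power_prod: "hom (power_prod x m) = power_prod (\<lambda>v. hom (x v)) m"
  by (simp add: power_prod_def hom_prod hom_power)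

lemma hom_ev:
  assumes "comm_ring_hom h"
  shows "h (ev c x f) = ev (\<lambda>a. h (c a)) (\<lambda>v. h (x v)) f"
proof -
  interpret comm_ring_hom h by fact
  show ?thesis by (simp add: ev_def hom_sum hom_mult hom_power_prod)
qed

lemma power_prod_indet:
  "power_prod indet m = (Poly_Mapping.single m 1 :: 'k::field ypoly)"
proof -
  have "indet v ^ n = (Poly_Mapping.single (Poly_Mapping.single v n) 1 :: 'k ypoly)" for v n
    by (induction n) (simp_all add: indet_def mult_single single_add[symmetric])
  then have "power_prod indet m = (\<Prod>v\<in>Poly_Mapping.keys m.
      Poly_Mapping.single (Poly_Mapping.single v (Poly_Mapping.lookup m v)) (1::'k))"
    by (simp add: power_prod_def)
  also have "\<dots> = Poly_Mapping.single (\<Sum>v\<in>Poly_Mapping.keys m. Poly_Mapping.single v (Poly_Mapping.lookup m v)) 1"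
  proof -
    have "(\<Prod>v\<in>A. Poly_Mapping.single (f v) (1::'k)) = Poly_Mapping.single (sum f A) 1"
      for A and f :: "nat \<times> nat \<Rightarrow> (nat \<times> nat) \<Rightarrow>\<^sub>0 nat"
      by (induction A rule: infinite_finite_induct) (simp_all add: mult_single)
    then show ?thesis .
  qed
  also have "(\<Sum>v\<in>Poly_Mapping.keys m. Poly_Mapping.single v (Poly_Mapping.lookup m v)) = m"
    by (intro poly_mapping_eqI) (auto simp: lookup_sum lookup_single when_def in_keys_iff sum.delta')
  finally show ?thesis .
qed

lemma const_hom: "comm_ring_hom (Poly_Mapping.single 0 :: 'k::comm_ring_1 \<Rightarrow> ('b::comm_monoid_add \<Rightarrow>\<^sub>0 'k))"
  by unfold_locales (simp_all add: single_add mult_single)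

lemma ev_id: "ev (Poly_Mapping.single 0) indet f = (f :: 'k::field ypoly)"
proof -
  interpret comm_ring_hom "Poly_Mapping.single 0 :: 'k \<Rightarrow> 'k ypoly" by (rule const_hom)
  show ?thesis
    by (induction f rule: single_induct) (simp_all add: ev_0 ev_single ev_add power_prod_indet mult_single)
qed

section \<open>Exponent vectors and traces of polynomials\<close>

definition smul :: "nat \<Rightarrow> ('v \<Rightarrow>\<^sub>0 nat) \<Rightarrow> ('v \<Rightarrow>\<^sub>0 nat)" where
  "smul k m = Poly_Mapping.map ((*) k) m"

lemma lookup_smul [simp]: "Poly_Mapping.lookup (smul k m) v = k * Poly_Mapping.lookup m v"
  by (simp add: smul_def map.rep_eq when_def)

lemma smul_add: "smul k (m + n) = smul k m + smul k n"
  by (intro poly_mapping_eqI) (simp add: lookup_add distrib_left)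

lemma single_power: "Poly_Mapping.single m a ^ n = Poly_Mapping.single (smul n m) (a ^ n)"
proof (induction n)
  case 0
  have "smul 0 m = 0" by (intro poly_mapping_eqI) simp
  then show ?case by simp
next
  case (Suc n)
  have "smul (Suc n) m = m + smul n m" by (intro poly_mapping_eqI) (simp add: lookup_add)
  with Suc show ?case by (simp add: mult_single)
qed

lemma lookup_single_mult:
  fixes f :: "('v \<Rightarrow>\<^sub>0 nat) \<Rightarrow>\<^sub>0 'k::comm_ring_1"
  shows "Poly_Mapping.lookup (Poly_Mapping.single k a * f) (k + n) = a * Poly_Mapping.lookup f n"
  by (induction f rule: single_induct)
    (simp_all add: mult_single lookup_single lookup_add distrib_left when_def)

lemma lookup_single_mult_eq_0:
  fixes f :: "('v \<Rightarrow>\<^sub>0 nat) \<Rightarrow>\<^sub>0 'k::comm_ring_1"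
  assumes "\<And>m. n \<noteq> k + m"
  shows "Poly_Mapping.lookup (Poly_Mapping.single k a * f) n = 0"
  using assms
  by (induction f rule: single_induct)
    (auto simp: mult_single lookup_single lookup_add distrib_left when_def)

lemma CHAR_poly_mapping:
  assumes "prime p" "CHAR('k::comm_ring_1) = p"
  shows "CHAR('b::comm_monoid_add \<Rightarrow>\<^sub>0 'k) = p"
proof (rule CHAR_eqI[OF assms(1)])
  have "of_nat p = (0 :: 'k)" using assms of_nat_CHAR by metis
  then show "of_nat p = (0 :: 'b \<Rightarrow>\<^sub>0 'k)" by (metis single_of_nat single_zero)
qed

text \<open>Let the field act on itself by a . x = a^p x. The vector 1 is independent, so it extends
  to a basis, and a linear functional with value 1 on it is the required \<theta>.\<close>

lemma ex_frobenius_section_field: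
  assumes p: "prime p" and CHAR: "CHAR('k::field) = p"
  shows "\<exists>\<theta> :: 'k \<Rightarrow> 'k. (\<forall>x y. \<theta> (x + y) = \<theta> x + \<theta> y) \<and> (\<forall>a x. \<theta> (a ^ p * x) = a * \<theta> x) \<and> \<theta> 1 = 1"
proof -
  have fd: "(x + y) ^ p = x ^ p + y ^ p" for x y :: 'k
    by (rule freshmans_dream) (simp_all add: CHAR p)
  interpret vector_space_pair "\<lambda>a x. a ^ p * x :: 'k" "(*) :: 'k \<Rightarrow> 'k \<Rightarrow> 'k"
    by unfold_locales (simp_all add: algebra_simps fd power_mult_distrib)
  have "vs1.independent {1 :: 'k}"
    by simp
  then obtain g :: "'k \<Rightarrow> 'k" where g: "Vector_Spaces.linear (\<lambda>a x. a ^ p * x) (*) g" "\<forall>x\<in>{1}. g x = 1"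
    using linear_independent_extend[of "{1}" "\<lambda>_. 1"] by blast
  interpret g: Vector_Spaces.linear "\<lambda>a x. a ^ p * x :: 'k" "(*) :: 'k \<Rightarrow> 'k \<Rightarrow> 'k" g by fact
  show ?thesis using g.add g.scale g(2) by auto
qed

text \<open>\<open>ob\<close> is the exponent vector that the trace singles out: exponents p n + ob
  go to n, and all other monomials vanish. As its entries are below \<open>p\<close>, they are the
  residues of these exponents modulo \<open>p\<close>.\<close>

locale poly_trace =
  fixes p :: nat and \<theta> :: "'k::field \<Rightarrow> 'k" and ob :: "'v \<Rightarrow>\<^sub>0 nat"
  assumes p: "prime p" and CHAR: "CHAR('k) = p"
    and \<theta>_add: "\<theta> (a + b) = \<theta> a + \<theta> b" and \<theta>_lin: "\<theta> (c ^ p * a) = c * \<theta> a" and \<theta>_1: "\<theta> 1 = 1"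
    and ob_less: "Poly_Mapping.lookup ob v < p"
begin

lemma p_pos: "p > 0" using p prime_gt_0_nat by blast

lemma \<theta>_0 [simp]: "\<theta> 0 = 0" using \<theta>_add[of 0 0] by (metis add_cancel_right_right add_0)

definition Tr :: "(('v \<Rightarrow>\<^sub>0 nat) \<Rightarrow>\<^sub>0 'k) \<Rightarrow> (('v \<Rightarrow>\<^sub>0 nat) \<Rightarrow>\<^sub>0 'k)" where
  "Tr f = Abs_poly_mapping (\<lambda>n. \<theta> (Poly_Mapping.lookup f (smul p n + ob)))"

lemma smul_inj: "smul p m = smul p n \<longleftrightarrow> m = n"
proof
  assume "smul p m = smul p n"
  then have "p * Poly_Mapping.lookup m v = p * Poly_Mapping.lookup n v" for v
    by (metis lookup_smul)
  then show "m = n" using p_pos by (intro poly_mapping_eqI) simp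
qed simp

lemma lookup_Tr: "Poly_Mapping.lookup (Tr f) n = \<theta> (Poly_Mapping.lookup f (smul p n + ob))"
proof -
  have "finite ((\<lambda>n. smul p n + ob) -` Poly_Mapping.keys f)"
    by (rule finite_vimageI) (auto intro!: injI simp: smul_inj)
  then have "finite {n. \<theta> (Poly_Mapping.lookup f (smul p n + ob)) \<noteq> 0}"
    by (rule rev_finite_subset) (auto simp: in_keys_iff)
  then show ?thesis by (simp add: Tr_def)
qed

lemma Tr_add: "Tr (f + g) = Tr f + Tr g"
  by (intro poly_mapping_eqI) (simp add: lookup_Tr lookup_add \<theta>_add)

lemma Tr_single_mult: "Tr (Poly_Mapping.single (smul p k) (a ^ p) * f) = Poly_Mapping.single k a * Tr f"
proof (rule poly_mapping_eqI)
  fix n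
  show "Poly_Mapping.lookup (Tr (Poly_Mapping.single (smul p k) (a ^ p) * f)) n
      = Poly_Mapping.lookup (Poly_Mapping.single k a * Tr f) n"
  proof (cases "\<exists>m. n = k + m")
    case True
    then obtain m where m: "n = k + m" by blast
    show ?thesis
      using lookup_single_mult[of "smul p k" "a ^ p" f "smul p m + ob"]
      by (simp add: m lookup_single_mult lookup_Tr smul_add \<theta>_lin add.assoc)
  next
    case False
    \<comment> \<open>An equality would give p k \<le> p n + ob < p (n + 1) in each variable, so k
      \<le> n. The truncated difference n - k is then a true difference, against the case
      assumption.\<close>
    have "smul p n + ob \<noteq> smul p k + m" for m
    proof
      assume *: "smul p n + ob = smul p k + m"
      have "n = k + (n - k)"
      proof (rule poly_mapping_eqI)
        fix v
        have "p * Poly_Mapping.lookup k v \<le> p * Poly_Mapping.lookup n v + Poly_Mapping.lookup ob v"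
          using arg_cong[OF *, of "\<lambda>m. Poly_Mapping.lookup m v"] by (simp add: lookup_add)
        also have "\<dots> < p * Suc (Poly_Mapping.lookup n v)" using ob_less by simp
        finally have "Poly_Mapping.lookup k v \<le> Poly_Mapping.lookup n v"
          by (metis less_Suc_eq_le mult_less_cancel1)
        then show "Poly_Mapping.lookup n v = Poly_Mapping.lookup (k + (n - k)) v"
          by (simp add: lookup_add lookup_minus)
      qed
      then show False using False by blast
    qed
    then show ?thesis using False by (simp add: lookup_Tr lookup_single_mult_eq_0)
  qed
qed

lemma Tr_lin: "Tr (a ^ p * f) = a * Tr f"
proof (induction a rule: single_induct)
  case zero
  have "Tr 0 = 0" by (intro poly_mapping_eqI) (simp add: lookup_Tr)
  then show ?case by (simp add: zero_power[OF p_pos])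
next
  case (single m a)
  then show ?case by (simp add: single_power Tr_single_mult)
next
  case (add a b)
  have "(a + b) ^ p = a ^ p + b ^ p"
    by (rule freshmans_dream) (simp_all add: CHAR_poly_mapping[OF p CHAR] p)
  with add show ?case by (simp add: distrib_right Tr_add)
qed

lemma keys_Tr: "n \<in> Poly_Mapping.keys (Tr f) \<Longrightarrow> smul p n + ob \<in> Poly_Mapping.keys f"
  by (auto simp: in_keys_iff lookup_Tr)

end

section \<open>Weights and leading terms\<close>

definition wt :: "('v \<Rightarrow> nat) \<Rightarrow> ('v \<Rightarrow>\<^sub>0 nat) \<Rightarrow> nat" where
  "wt w m = (\<Sum>v\<in>Poly_Mapping.keys m. w v * Poly_Mapping.lookup m v)"

lemma wt_add: "wt w (m + n) = wt w m + wt w n"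
  unfolding wt_def by (rule setsum_keys_plus_distrib) (simp_all add: distrib_left)

lemma wt_0 [simp]: "wt w 0 = 0" by (simp add: wt_def)

lemma wt_single [simp]: "wt w (Poly_Mapping.single v n) = w v * n"
  by (simp add: wt_def)

lemma wt_sum: "wt w (sum f A) = (\<Sum>i\<in>A. wt w (f i))"
  by (induction A rule: infinite_finite_induct) (simp_all add: wt_add)

text \<open>The leading term has coefficient 1 and is the only one of maximal weight; the lower
  terms may tie among themselves, so a weight can replace a monomial order.\<close>

definition lead :: "('v \<Rightarrow> nat) \<Rightarrow> (('v \<Rightarrow>\<^sub>0 nat) \<Rightarrow>\<^sub>0 'k::comm_ring_1) \<Rightarrow> ('v \<Rightarrow>\<^sub>0 nat) \<Rightarrow> bool" where
  "lead w f m \<longleftrightarrow> (\<exists>g. f = Poly_Mapping.single m 1 + g \<and> (\<forall>k\<in>Poly_Mapping.keys g. wt w k < wt w m))"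

lemma lead_1: "lead w 1 0"
  by (auto simp: lead_def intro!: exI[of _ 0])

lemma lead_mult:
  assumes "lead w f m" "lead w g n"
  shows "lead w (f * g) (m + n)"
proof -
  obtain f' g' where f: "f = Poly_Mapping.single m 1 + f'" "\<forall>k\<in>Poly_Mapping.keys f'. wt w k < wt w m"
    and g: "g = Poly_Mapping.single n 1 + g'" "\<forall>k\<in>Poly_Mapping.keys g'. wt w k < wt w n"
    using assms by (auto simp: lead_def)
  let ?h = "Poly_Mapping.single m 1 * g' + f' * g"
  have "Poly_Mapping.single m 1 * g = Poly_Mapping.single (m + n) 1 + Poly_Mapping.single m 1 * g'"
    by (simp add: g(1) distrib_left mult_single)
  then have "f * g = Poly_Mapping.single (m + n) 1 + ?h"
    by (simp add: f(1) distrib_right add.assoc)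
  moreover have "wt w k < wt w (m + n)" if "k \<in> Poly_Mapping.keys ?h" for k
  proof -
    consider "k \<in> Poly_Mapping.keys (Poly_Mapping.single m 1 * g')" | "k \<in> Poly_Mapping.keys (f' * g)"
      using \<open>k \<in> _\<close> keys_add[of "Poly_Mapping.single m 1 * g'" "f' * g"] by blast
    then show ?thesis
    proof cases
      case 1
      then obtain l where "k = m + l" "l \<in> Poly_Mapping.keys g'"
        using keys_mult[of "Poly_Mapping.single m 1" g'] by (auto split: if_splits)
      then show ?thesis using g(2) by (simp add: wt_add)
    next
      case 2
      then obtain a b where ab: "k = a + b" "a \<in> Poly_Mapping.keys f'" "b \<in> Poly_Mapping.keys g"
        using keys_mult[of f' g] by auto
      have "b \<in> {n} \<union> Poly_Mapping.keys g'"
        using ab(3) g(1) keys_add[of "Poly_Mapping.single n 1" g'] by (auto split: if_splits)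
      then have "wt w b \<le> wt w n" using g(2) by (auto simp: less_imp_le)
      then show ?thesis using ab f(2) by (auto simp: wt_add intro: add_less_le_mono)
    qed
  qed
  ultimately show ?thesis unfolding lead_def by blast
qed

lemma lead_power: "lead w f m \<Longrightarrow> lead w (f ^ n) (smul n m)"
proof (induction n)
  case 0
  have "smul 0 m = 0" by (intro poly_mapping_eqI) simp
  then show ?case by (simp add: lead_1)
next
  case (Suc n)
  have "smul (Suc n) m = m + smul n m" by (intro poly_mapping_eqI) (simp add: lookup_add)
  with Suc lead_mult[of w f m "f ^ n" "smul n m"] show ?case by simp
qed

lemma lead_prod: "(\<And>i. i \<in> A \<Longrightarrow> lead w (f i) (m i)) \<Longrightarrow> lead w (prod f A) (sum m A)"
  by (induction A rule: infinite_finite_induct) (simp_all add: lead_1 lead_mult)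

text \<open>Every exponent p n + ob weighs at least as much as ob. Hence the lower terms of
  \<open>f\<close> are not seen by the trace, and the leading term is seen only at n = 0.\<close>

lemma (in poly_trace) Tr_lead:
  assumes w: "\<And>v. w v > 0" and f: "lead w f ob"
  shows "Tr f = 1"
proof -
  obtain g where g: "f = Poly_Mapping.single ob 1 + g" "\<forall>k\<in>Poly_Mapping.keys g. wt w k < wt w ob"
    using f by (auto simp: lead_def)
  have "Poly_Mapping.lookup g (smul p n + ob) = 0" for n
    using g(2) wt_add[of w "smul p n" ob] by (metis in_keys_iff not_add_less2)
  moreover have "smul p n = 0 \<longleftrightarrow> n = 0" for n
    using smul_inj[of n 0] by (auto simp: poly_mapping_eq_iff fun_eq_iff p_pos)
  ultimately show ?thesis
    by (intro poly_mapping_eqI)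
      (auto simp: g lookup_Tr lookup_add lookup_single lookup_one \<theta>_add \<theta>_1 when_def)
qed

section \<open>The polynomial ring of the symmetric matrix\<close>

abbreviation sym_vars where "sym_vars r \<equiv> {(i, j). i \<le> j \<and> j < (r::nat)}"

lemma sym_poly_ring_iff: "f \<in> sym_poly_ring r \<longleftrightarrow> (\<forall>m\<in>Poly_Mapping.keys f. Poly_Mapping.keys m \<subseteq> sym_vars r)"
  by (simp add: sym_poly_ring_def)

lemma subdomain_sym_poly_ring: "subdomain (sym_poly_ring r :: 'k::field ypoly set)"
proof
  fix x y :: "'k ypoly" assume *: "x \<in> sym_poly_ring r" "y \<in> sym_poly_ring r"
  show "x + y \<in> sym_poly_ring r"
    using * keys_add[of x y] unfolding sym_poly_ring_iff by blast
  show "x * y \<in> sym_poly_ring r"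
    unfolding sym_poly_ring_iff
  proof
    fix m assume "m \<in> Poly_Mapping.keys (x * y)"
    then obtain a b where "m = a + b" "a \<in> Poly_Mapping.keys x" "b \<in> Poly_Mapping.keys y"
      using keys_mult[of x y] by auto
    then show "Poly_Mapping.keys m \<subseteq> sym_vars r"
      using * keys_add[of a b] unfolding sym_poly_ring_iff by blast
  qed
  show "- x \<in> sym_poly_ring r" using * by (auto simp: sym_poly_ring_iff in_keys_iff)
qed (auto simp: sym_poly_ring_iff)

lemma indet_sym_poly_ring: "v \<in> sym_vars r \<Longrightarrow> indet v \<in> sym_poly_ring r"
  by (auto simp: sym_poly_ring_iff indet_def)

lemma const_sym_poly_ring: "Poly_Mapping.single 0 a \<in> sym_poly_ring r"
  by (auto simp: sym_poly_ring_iff)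

subsection \<open>Minors\<close>

text \<open>A Schur complement without division. Right multiplication by the block upper triangular
  matrix \<open>B\<close> makes the bordered matrix block lower triangular. In the comparison of
  determinants det(det A . 1) appears on both sides and cancels in a domain.\<close>

lemma det_bordered:
  fixes A :: "'a::idom mat"
  assumes A: "A \<in> carrier_mat n n" and b: "b \<in> carrier_mat n 1" and c: "c \<in> carrier_mat 1 n"
    and d: "d \<in> carrier_mat 1 1" and nz: "det A \<noteq> 0"
  shows "det (four_block_mat A b c d) = det A * d $$ (0, 0) - (c * (adj_mat A * b)) $$ (0, 0)"
proof -
  note adj = adj_mat[OF A]
  define ab where "ab = adj_mat A * b"
  have ab: "ab \<in> carrier_mat n 1" using adj(1) b by (simp add: ab_def)
  define B where "B = four_block_mat (adj_mat A) (- ab) (0\<^sub>m 1 n) (det A \<cdot>\<^sub>m 1\<^sub>m 1)"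
  define D where "D = det A \<cdot>\<^sub>m d - c * ab"
  have "A * ab = (A * adj_mat A) * b"
    unfolding ab_def by (rule assoc_mult_mat[symmetric, OF A adj(1) b])
  then have Aab: "A * ab = det A \<cdot>\<^sub>m b"
    using mult_smult_assoc_mat[of "1\<^sub>m n" n n b 1 "det A"] b by (simp add: adj(2))
  have "four_block_mat A b c d * B =
      four_block_mat (A * adj_mat A + b * 0\<^sub>m 1 n) (A * (- ab) + b * (det A \<cdot>\<^sub>m 1\<^sub>m 1))
        (c * adj_mat A + d * 0\<^sub>m 1 n) (c * (- ab) + d * (det A \<cdot>\<^sub>m 1\<^sub>m 1))"
    unfolding B_def by (rule mult_four_block_mat[OF A b c d adj(1)]) (use ab in auto)
  also have "A * adj_mat A + b * 0\<^sub>m 1 n = det A \<cdot>\<^sub>m 1\<^sub>m n"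
    using b by (simp add: adj)
  also have "A * (- ab) + b * (det A \<cdot>\<^sub>m 1\<^sub>m 1) = 0\<^sub>m n 1"
  proof -
    have "A * (- ab) = - (det A \<cdot>\<^sub>m b)" using A ab Aab by (simp add: uminus_mult_right_mat)
    moreover have "b * (det A \<cdot>\<^sub>m 1\<^sub>m 1) = det A \<cdot>\<^sub>m b"
      using mult_smult_distrib[OF b, of "1\<^sub>m 1" 1 "det A"] b by simp
    ultimately show ?thesis using b by (intro eq_matI) auto
  qed
  also have "c * adj_mat A + d * 0\<^sub>m 1 n = c * adj_mat A" using c d adj(1) by simp
  also have "c * (- ab) + d * (det A \<cdot>\<^sub>m 1\<^sub>m 1) = D"
  proof -
    have "c * (- ab) = - (c * ab)" using c ab by (simp add: uminus_mult_right_mat)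
    moreover have "d * (det A \<cdot>\<^sub>m 1\<^sub>m 1) = det A \<cdot>\<^sub>m d"
      using mult_smult_distrib[OF d, of "1\<^sub>m 1" 1 "det A"] d by simp
    ultimately show ?thesis using c d ab by (intro eq_matI) (auto simp: D_def)
  qed
  finally have prod: "four_block_mat A b c d * B =
    four_block_mat (det A \<cdot>\<^sub>m 1\<^sub>m n) (0\<^sub>m n 1) (c * adj_mat A) D" .
  have D: "D \<in> carrier_mat 1 1" unfolding D_def by (rule minus_carrier_mat[OF mult_carrier_mat[OF c ab]])
  have F: "four_block_mat A b c d \<in> carrier_mat (n + 1) (n + 1)" using A d by (intro four_block_carrier_mat)
  have B: "B \<in> carrier_mat (n + 1) (n + 1)" using adj(1) unfolding B_def by (intro four_block_carrier_mat) auto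
  have detD: "det D = D $$ (0, 0)" by (rule det_single[OF D])
  have "det (four_block_mat A b c d) * det B = det (four_block_mat A b c d * B)"
    by (rule det_mult[symmetric, OF F B])
  also have "\<dots> = det (det A \<cdot>\<^sub>m 1\<^sub>m n) * det D"
    unfolding prod by (rule det_four_block_mat_upper_right_zero_col) (use c adj D in auto)
  also have "det B = det (adj_mat A) * det (det A \<cdot>\<^sub>m 1\<^sub>m 1)"
    unfolding B_def by (rule det_four_block_mat_lower_left_zero[OF adj(1)]) (use ab in auto)
  also have "det (adj_mat A) * det (det A \<cdot>\<^sub>m 1\<^sub>m 1) = det (det A \<cdot>\<^sub>m 1\<^sub>m n)"
    using det_mult[OF A adj(1)] by (simp add: adj mult.commute)
  finally have "det (four_block_mat A b c d) * det (det A \<cdot>\<^sub>m 1\<^sub>m n) = det (det A \<cdot>\<^sub>m 1\<^sub>m n) * det D" .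
  moreover have "det (det A \<cdot>\<^sub>m 1\<^sub>m n) \<noteq> 0" using nz by simp
  ultimately have "det (four_block_mat A b c d) = D $$ (0, 0)"
    unfolding detD mult.commute[of "det (four_block_mat A b c d)"] by (metis mult_left_cancel)
  then show ?thesis using b c d by (simp add: D_def ab_def)
qed

text \<open>Rows and columns are selected by functions and not by sets, so that they may repeat and
  come in any order. Bordering a minor is then a function update.\<close>

definition fminor :: "nat \<Rightarrow> (nat \<Rightarrow> nat \<Rightarrow> 'a::comm_ring_1) \<Rightarrow> (nat \<Rightarrow> nat) \<Rightarrow> (nat \<Rightarrow> nat) \<Rightarrow> 'a" where
  "fminor k A u v = det (mat k k (\<lambda>(i, j). A (u i) (v j)))"

definition adj_entry where
  "adj_entry k A u v l m = adj_mat (mat k k (\<lambda>(i, j). A (u i) (v j))) $$ (l, m)"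

lemma fminor_cong: "(\<And>i j. i < k \<Longrightarrow> j < k \<Longrightarrow> A (u i) (v j) = B (u' i) (v' j)) \<Longrightarrow> fminor k A u v = fminor k B u' v'"
  unfolding fminor_def by (rule arg_cong[of _ _ det], rule eq_matI) auto

lemma fminor_transpose: "fminor k A u v = fminor k (\<lambda>i j. A j i) v u"
proof -
  have "mat k k (\<lambda>(i, j). A (u j) (v i)) = transpose_mat (mat k k (\<lambda>(i, j). A (u i) (v j)))"
    by (rule eq_matI) auto
  then show ?thesis using det_transpose[of "mat k k (\<lambda>(i, j). A (u i) (v j))" k] by (simp add: fminor_def)
qed

lemma permutes_less: "\<sigma> permutes {0..<k} \<Longrightarrow> i < k \<Longrightarrow> \<sigma> i < k" for i :: nat
  using permutes_in_image[of \<sigma> "{0..<k}" i] by simp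

lemma fminor_leibniz: "fminor k A u v = (\<Sum>\<sigma> | \<sigma> permutes {0..<k}. signof \<sigma> * (\<Prod>i = 0..<k. A (u i) (v (\<sigma> i))))"
  unfolding fminor_def
  by (subst det_def'[of _ k])
    (auto intro!: sum.cong prod.cong arg_cong2[of _ _ _ _ "(*)"] simp: permutes_less)

lemma fminor_identical_rows:
  assumes "i < k" "j < k" "i \<noteq> j" "\<And>m. m < k \<Longrightarrow> A (u i) (v m) = A (u j) (v m)"
  shows "fminor k A u v = 0"
  unfolding fminor_def
  by (rule det_identical_rows[of _ k i j]) (use assms in auto)

text \<open>With \<delta> the given minor, \<delta> times the matrix is a product that factors
  through k columns plus the matrix of bordered minors. Modulo an ideal containing the bordered
  minors, only the product of rank at most k remains.\<close>

lemma fminor_bordered: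
  fixes A :: "nat \<Rightarrow> nat \<Rightarrow> 'a::idom"
  assumes "fminor k A u v \<noteq> 0"
  shows "fminor k A u v * A a b =
    (\<Sum>l<k. A a (v l) * (\<Sum>m<k. adj_entry k A u v l m * A (u m) b)) +
    fminor (Suc k) A (u(k := a)) (v(k := b))"
proof -
  let ?M = "mat k k (\<lambda>(i, j). A (u i) (v j))"
  let ?b = "mat k 1 (\<lambda>(i, j). A (u i) b)" and ?c = "mat 1 k (\<lambda>(i, j). A a (v j))"
  let ?d = "mat 1 1 (\<lambda>(i, j). A a b)"
  have "mat (Suc k) (Suc k) (\<lambda>(i, j). A ((u(k := a)) i) ((v(k := b)) j)) = four_block_mat ?M ?b ?c ?d"
    by (rule eq_matI) (auto simp: less_Suc_eq)
  then have "fminor (Suc k) A (u(k := a)) (v(k := b)) = fminor k A u v * A a b - (?c * (adj_mat ?M * ?b)) $$ (0, 0)"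
    using det_bordered[of ?M k ?b ?c ?d] assms by (simp add: fminor_def)
  also have "(?c * (adj_mat ?M * ?b)) $$ (0, 0) =
      (\<Sum>l<k. A a (v l) * (\<Sum>m<k. adj_entry k A u v l m * A (u m) b))"
    using adj_mat(1)[of ?M k]
    by (auto simp: scalar_prod_def adj_entry_def atLeast0LessThan intro!: sum.cong)
  finally show ?thesis by (simp only: diff_add_cancel add_diff_cancel_left' add.commute[of _ "_ - _"])
qed

text \<open>Multilinearity in the rows: \<open>g\<close> chooses one summand for each row.\<close>

lemma fminor_sum:
  assumes "finite L"
  shows "fminor k (\<lambda>i j. \<Sum>l\<in>L. E i l j) id id = (\<Sum>g\<in>{0..<k} \<rightarrow>\<^sub>E L. fminor k (\<lambda>i j. E i (g i) j) id id)"
proof -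
  have "fminor k (\<lambda>i j. \<Sum>l\<in>L. E i l j) id id =
      (\<Sum>\<sigma> | \<sigma> permutes {0..<k}. \<Sum>g\<in>{0..<k} \<rightarrow>\<^sub>E L. signof \<sigma> * (\<Prod>i = 0..<k. E i (g i) (\<sigma> i)))"
    unfolding fminor_leibniz by (simp add: prod_sum_PiE assms sum_distrib_left)
  also have "\<dots> = (\<Sum>g\<in>{0..<k} \<rightarrow>\<^sub>E L. fminor k (\<lambda>i j. E i (g i) j) id id)"
    unfolding fminor_leibniz by (subst sum.swap) simp
  finally show ?thesis .
qed

lemma fminor_scale_rows: "fminor k (\<lambda>i j. c i * A i j) id id = (\<Prod>i = 0..<k. c i) * fminor k A id id"
  unfolding fminor_leibniz by (simp add: prod.distrib sum_distrib_left algebra_simps)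

lemma fminor_hom: "comm_ring_hom h \<Longrightarrow> h (fminor k A u v) = fminor k (\<lambda>i j. h (A i j)) u v"
proof -
  assume "comm_ring_hom h"
  then interpret comm_ring_hom h .
  have "mat k k (\<lambda>(i, j). h (A (u i) (v j))) = map_mat h (mat k k (\<lambda>(i, j). A (u i) (v j)))"
    by (rule eq_matI) auto
  then show ?thesis by (simp add: fminor_def)
qed

section \<open>Minors and powers of ideals\<close>

context subdomain begin

lemma signof_R: "signof \<sigma> \<in> R"
  by (auto simp: sign_def)

lemma fminor_R:
  assumes "\<And>i j. i < k \<Longrightarrow> j < k \<Longrightarrow> A (u i) (v j) \<in> R"
  shows "fminor k A u v \<in> R"
  unfolding fminor_leibniz
  using assms by (intro R_sum R_mult R_prod signof_R) (auto simp: permutes_less)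

lemma adj_entry_R:
  assumes "\<And>i j. i < k \<Longrightarrow> j < k \<Longrightarrow> A (u i) (v j) \<in> R" and "l < k" "m < k"
  shows "adj_entry k A u v l m \<in> R"
proof -
  let ?M = "mat k k (\<lambda>(i, j). A (u i) (v j))"
  have D: "mat_delete ?M m l \<in> carrier_mat (k - 1) (k - 1)" by (rule mat_delete_carrier) simp
  have "mat_delete ?M m l = mat (k - 1) (k - 1) (\<lambda>(i, j). (\<lambda>i j. mat_delete ?M m l $$ (i, j)) (id i) (id j))"
    using D by (intro eq_matI) auto
  then have "det (mat_delete ?M m l) = fminor (k - 1) (\<lambda>i j. mat_delete ?M m l $$ (i, j)) id id"
    unfolding fminor_def by (rule arg_cong)
  also have "\<dots> \<in> R"
    by (rule fminor_R) (use assms in \<open>auto simp: mat_delete_def\<close>)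
  finally show ?thesis
    using assms(2,3) by (auto simp: adj_entry_def adj_mat_def cofactor_def intro!: R_mult R_power R_uminus)
qed

text \<open>In the expansion by rows each row chooses one of s vectors \<open>W l\<close> or its own
  row of \<open>Q\<close>. If two rows choose the same \<open>W l\<close>, the determinant vanishes;
  otherwise at least k - s rows come from \<open>Q\<close>, and every Leibniz term has that many
  factors in \<open>J\<close>.\<close>

lemma fminor_rank_perturbation:
  assumes J: "ideal J (ring_on R)"
    and X: "\<And>i l. i < k \<Longrightarrow> l < s \<Longrightarrow> U i l \<in> R" and W: "\<And>l j. l < s \<Longrightarrow> j < k \<Longrightarrow> W l j \<in> R"
    and Q: "\<And>i j. i < k \<Longrightarrow> j < k \<Longrightarrow> Q i j \<in> J"
  shows "fminor k (\<lambda>i j. (\<Sum>l<s. U i l * W l j) + Q i j) id id \<in> ipow J (k - s)"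
proof -
  \<comment> \<open>The index s stands for the summand \<open>Q i j\<close>, with scalar 1; below s
    the scalar \<open>U i l\<close> is split off from the row.\<close>
  define c where "c i l = (if l < s then U i l else 1)" for i l
  define B where "B i l j = (if l < s then W l j else Q i j)" for i l j
  have "(\<Sum>l<s. U i l * W l j) + Q i j = (\<Sum>l\<in>{..s}. c i l * B i l j)" for i j
  proof -
    have "(\<Sum>l\<in>{..s}. c i l * B i l j) = (\<Sum>l<s. c i l * B i l j) + c i s * B i s j"
      by (simp flip: lessThan_Suc_atMost)
    then show ?thesis by (simp add: c_def B_def)
  qed
  then have "fminor k (\<lambda>i j. (\<Sum>l<s. U i l * W l j) + Q i j) id id =
      (\<Sum>g\<in>{0..<k} \<rightarrow>\<^sub>E {..s}. (\<Prod>i = 0..<k. c i (g i)) * fminor k (\<lambda>i j. B i (g i) j) id id)"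
    by (simp add: fminor_sum fminor_scale_rows)
  also have "\<dots> \<in> ipow J (k - s)"
  proof (intro ideal_sum[OF ideal_ipow[OF J]] ideal_lmult[OF ideal_ipow[OF J]])
    fix g assume g: "g \<in> {0..<k} \<rightarrow>\<^sub>E {..s}"
    show "(\<Prod>i = 0..<k. c i (g i)) \<in> R" using X by (auto simp: c_def)
    show "fminor k (\<lambda>i j. B i (g i) j) id id \<in> ipow J (k - s)"
    proof (cases "inj_on g {i. i < k \<and> g i < s}")
      case False
      then obtain i j where "i < k" "j < k" "i \<noteq> j" "g i = g j" "g i < s" by (auto simp: inj_on_def)
      then have "fminor k (\<lambda>i j. B i (g i) j) id id = 0"
        by (intro fminor_identical_rows[of i k j]) (auto simp: B_def)
      then show ?thesis using ideal_0[OF ideal_ipow[OF J]] by simp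
    next
      case True
      define e where "e i = (if g i < s then 0 else 1 :: nat)" for i
      have "card {i. i < k \<and> g i < s} \<le> card {..<s}"
        by (rule card_inj_on_le[OF True]) auto
      moreover have "card {..<k} = card ({i. i < k \<and> g i < s} \<union> {i. i < k \<and> \<not> g i < s})"
        by (rule arg_cong[of _ _ card]) auto
      moreover have "\<dots> = card {i. i < k \<and> g i < s} + card {i. i < k \<and> \<not> g i < s}"
        by (rule card_Un_disjoint) auto
      moreover have "sum e {0..<k} = card {i. i < k \<and> \<not> g i < s}"
        by (auto simp: e_def sum.If_cases intro!: arg_cong[of _ _ card])
      ultimately have e: "k - s \<le> sum e {0..<k}" by simp
      have "fminor k (\<lambda>i j. B i (g i) j) id id \<in> ipow J (sum e {0..<k})"
        unfolding fminor_leibniz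
      proof (intro ideal_sum[OF ideal_ipow[OF J]] ideal_lmult[OF ideal_ipow[OF J]] signof_R ipow_prod[OF J])
        fix \<sigma> i assume "\<sigma> \<in> {\<sigma>. \<sigma> permutes {0..<k}}" "i \<in> {0..<k}"
        then have "i < k" "\<sigma> i < k" by (auto simp: permutes_less)
        then show "B (id i) (g (id i)) (id (\<sigma> i)) \<in> ipow J (e i)"
          using W Q ipow_1[OF J] by (auto simp: B_def e_def)
      qed
      then show ?thesis using ipow_antimono[OF J e] by blast
    qed
  qed
  finally show ?thesis .
qed

text \<open>One factor \<delta> for each of the k rows brings the matrix into the form rank s plus
  entries in \<open>J\<close>.\<close>

lemma fminor_pow_ipow:
  assumes J: "ideal J (ring_on R)" and nz: "fminor s A u v \<noteq> 0"
    and A: "\<And>i j. i < r \<Longrightarrow> j < r \<Longrightarrow> A i j \<in> R"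
    and uv: "\<And>i. i < s \<Longrightarrow> u i < r" "\<And>i. i < s \<Longrightarrow> v i < r"
    and M: "\<And>a b. a < r \<Longrightarrow> b < r \<Longrightarrow> fminor (Suc s) A (u(s := a)) (v(s := b)) \<in> J"
    and uv': "\<And>i. i < k \<Longrightarrow> u' i < r" "\<And>i. i < k \<Longrightarrow> v' i < r"
  shows "fminor s A u v ^ k * fminor k A u' v' \<in> ipow J (k - s)"
proof -
  let ?d = "fminor s A u v"
  define U where "U i l = A (u' i) (v l)" for i l
  define W where "W l j = (\<Sum>m<s. adj_entry s A u v l m * A (u m) (v' j))" for l j
  define Q where "Q i j = fminor (Suc s) A (u(s := u' i)) (v(s := v' j))" for i j
  have "?d ^ k * fminor k A u' v' = (\<Prod>i = 0..<k. ?d) * fminor k (\<lambda>i j. A (u' i) (v' j)) id id"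
    by (simp add: fminor_def)
  also have "\<dots> = fminor k (\<lambda>i j. ?d * A (u' i) (v' j)) id id"
    by (rule fminor_scale_rows[symmetric])
  also have "\<dots> = fminor k (\<lambda>i j. (\<Sum>l<s. U i l * W l j) + Q i j) id id"
    by (simp only: fminor_bordered[OF nz] U_def W_def Q_def)
  also have "\<dots> \<in> ipow J (k - s)"
    by (rule fminor_rank_perturbation[OF J])
      (use A uv uv' M in \<open>auto simp: U_def W_def Q_def intro!: R_sum R_mult adj_entry_R\<close>)
  finally show ?thesis .
qed

lemma mult_pow_ipow:
  assumes I: "ideal I (ring_on R)" and J: "ideal J (ring_on R)" and d: "d \<in> R" "\<And>x. x \<in> I \<Longrightarrow> d * x \<in> J"
  shows "x \<in> ipow I n \<Longrightarrow> d ^ n * x \<in> ipow J n"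
proof (induction n arbitrary: x)
  case 0
  then show ?case by simp
next
  case (Suc n)
  from Suc.prems[unfolded ipow_Suc] show ?case
  proof (induction rule: ideal_prod.induct)
    case (prod i j)
    have "(d ^ n * i) * (d * j) \<in> ipow J (n + 1)"
      using ipow_mult[OF J Suc.IH[OF prod(1)], of "d * j" 1] ipow_1[OF J d(2)[OF prod(2)]] by simp
    then show ?case by (simp add: algebra_simps)
  next
    case (sum x y)
    then show ?case using ideal_add[OF ideal_ipow[OF J]] by (simp add: distrib_left)
  qed
qed

text \<open>Additively, the n-th power of a finitely generated ideal is generated by the R-multiples
  of the monomials of degree n in the generators, so additive properties can be checked on
  these.\<close>

lemma ipow_Idl_induct:
  assumes fin: "finite B" and \<gamma>: "\<And>b. b \<in> B \<Longrightarrow> \<gamma> b \<in> R"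
    and P0: "P 0" and Padd: "\<And>x y. P x \<Longrightarrow> P y \<Longrightarrow> P (x + y)"
    and Pmon: "\<And>c e. c \<in> R \<Longrightarrow> sum e B = n \<Longrightarrow> P (c * (\<Prod>b\<in>B. \<gamma> b ^ e b))"
    and x: "x \<in> ipow (Idl\<^bsub>ring_on R\<^esub> (\<gamma> ` B)) n"
  shows "P x"
  using P0 Padd Pmon x
proof (induction n arbitrary: P x)
  case 0
  from 0(3)[of x "\<lambda>_. 0"] 0(4) show ?case by simp
next
  case (Suc n)
  let ?J = "Idl\<^bsub>ring_on R\<^esub> (\<gamma> ` B)"
  have sub: "\<gamma> ` B \<subseteq> R" using \<gamma> by auto
  have J: "ideal ?J (ring_on R)" by (rule ideal_Idl[OF sub])
  have mon: "\<forall>j\<in>?J. P (c * (\<Prod>b\<in>B. \<gamma> b ^ e b) * j)" if c: "c \<in> R" and e: "sum e B = n" for c e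
  proof -
    \<comment> \<open>The possible last factors form an ideal containing the generators, hence all
      of \<open>?J\<close>. The coefficient \<open>c\<close> is quantified inside \<open>K\<close>
      so that \<open>K\<close> absorbs multiplication by \<open>R\<close>.\<close>
    define K where "K = {j \<in> R. \<forall>c\<in>R. P (c * (\<Prod>b\<in>B. \<gamma> b ^ e b) * j)}"
    have "ideal K (ring_on R)"
      unfolding ideal_ring_on_iff
    proof (intro conjI ballI)
      fix a x assume "a \<in> R" "x \<in> K"
      then have "P ((c * a) * (\<Prod>b\<in>B. \<gamma> b ^ e b) * x)" if "c \<in> R" for c
        using that unfolding K_def by blast
      then show "a * x \<in> K" using \<open>a \<in> R\<close> \<open>x \<in> K\<close> by (auto simp: K_def algebra_simps)
    qed (use Suc.prems(1,2) in \<open>auto simp: K_def distrib_left\<close>)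
    moreover have "\<gamma> ` B \<subseteq> K"
    proof
      fix j assume "j \<in> \<gamma> ` B"
      then obtain b where b: "b \<in> B" "j = \<gamma> b" by blast
      have "(\<Prod>b'\<in>B. \<gamma> b' ^ (e(b := Suc (e b))) b') = \<gamma> b * (\<Prod>b\<in>B. \<gamma> b ^ e b)"
        using fin b(1) by (simp add: prod.remove[of B b] mult.assoc)
      moreover have "sum (e(b := Suc (e b))) B = Suc n"
        using fin b(1) e by (simp add: sum.remove[of B b])
      ultimately have "P (c * (\<gamma> b * (\<Prod>b\<in>B. \<gamma> b ^ e b)))" if "c \<in> R" for c
        using Suc.prems(3)[OF that, of "e(b := Suc (e b))"] by simp
      then show "j \<in> K" using b \<gamma> by (auto simp: K_def algebra_simps)
    qed
    ultimately have "?J \<subseteq> K" by (rule Idl_minimal)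
    then show ?thesis using c by (auto simp: K_def)
  qed
  from Suc.prems(4)[unfolded ipow_Suc] show ?case
  proof (induction rule: ideal_prod.induct)
    case (prod i j)
    \<comment> \<open>The induction hypothesis is used for the predicate that treats all last
      factors at once; this predicate is again additive.\<close>
    have "\<forall>j\<in>?J. P (i * j)"
    proof (rule Suc.IH[where P = "\<lambda>i. \<forall>j\<in>?J. P (i * j)"])
      show "i \<in> ipow ?J n" using prod by simp
    qed (use Suc.prems(1,2) mon in \<open>auto simp: distrib_right\<close>)
    then show ?case using prod by simp
  qed (use Suc.prems(2) in auto)
qed

text \<open>
  An ideal with \<open>h\<close> generators satisfies \<open>J\<^bsup>np+1+h(p-1)\<^esup> \<subseteq> (J\<^bsup>n+1\<^esup>)\<^bsup>[p]\<^esup>\<close> by the pigeonhole principle.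
\<close>

lemma p_linear_ipow:
  assumes fin: "finite B" and \<gamma>: "\<And>b. b \<in> B \<Longrightarrow> \<gamma> b \<in> R" and p: "p > 0"
    and T_R: "\<And>x. x \<in> R \<Longrightarrow> T x \<in> R" and T_add: "\<And>x y. T (x + y) = T x + T y"
    and T_lin: "\<And>a x. a \<in> R \<Longrightarrow> T (a ^ p * x) = a * T x"
    and x: "x \<in> ipow (Idl\<^bsub>ring_on R\<^esub> (\<gamma> ` B)) (n * p + 1 + card B * (p - 1))"
  shows "T x \<in> ipow (Idl\<^bsub>ring_on R\<^esub> (\<gamma> ` B)) (n + 1)"
proof (rule ipow_Idl_induct[OF fin \<gamma> _ _ _ x])
  let ?J = "Idl\<^bsub>ring_on R\<^esub> (\<gamma> ` B)"
  have sub: "\<gamma> ` B \<subseteq> R" using \<gamma> by auto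
  have J: "ideal ?J (ring_on R)" by (rule ideal_Idl[OF sub])
  have "T 0 = 0" using T_add[of 0 0] by (metis add_cancel_right_right add_0)
  then show "T 0 \<in> ipow ?J (n + 1)" using ideal_0[OF ideal_ipow[OF J]] by simp
  show "T (x + y) \<in> ipow ?J (n + 1)" if "T x \<in> ipow ?J (n + 1)" "T y \<in> ipow ?J (n + 1)" for x y
    using ideal_add[OF ideal_ipow[OF J]] that by (simp add: T_add)
  fix c e assume c: "c \<in> R" and e: "sum e B = n * p + 1 + card B * (p - 1)"
  \<comment> \<open>Taking out the p-th power of \<open>a\<close> leaves exponents at most p - 1, so
    total degree at most \<open>card B * (p - 1)\<close>. Hence \<open>a ^ p\<close> has degree
    above n p, and \<open>a\<close> has degree above n.\<close>
  define a where "a = (\<Prod>b\<in>B. \<gamma> b ^ (e b div p))"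
  have a: "a \<in> ipow ?J (\<Sum>b\<in>B. e b div p)"
    unfolding a_def
  proof (rule ipow_prod[OF J])
    fix b assume "b \<in> B"
    then have "\<gamma> b \<in> ipow ?J 1" using Idl_incl[OF sub] by (intro ipow_1[OF J]) auto
    then show "\<gamma> b ^ (e b div p) \<in> ipow ?J (e b div p)" using ipow_power[OF J, of "\<gamma> b" 1] by simp
  qed
  have "(\<Prod>b\<in>B. \<gamma> b ^ e b) = a ^ p * (\<Prod>b\<in>B. \<gamma> b ^ (e b mod p))"
    unfolding a_def by (simp add: prod_power_distrib flip: prod.distrib power_mult power_add)
  then have "T (c * (\<Prod>b\<in>B. \<gamma> b ^ e b)) = a * T (c * (\<Prod>b\<in>B. \<gamma> b ^ (e b mod p)))"
    using T_lin[of a "c * (\<Prod>b\<in>B. \<gamma> b ^ (e b mod p))"] ideal_sub[OF ideal_ipow[OF J] a]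
    by (simp add: algebra_simps)
  also have "\<dots> \<in> ipow ?J (\<Sum>b\<in>B. e b div p)"
    using c \<gamma> by (intro ideal_rmult[OF ideal_ipow[OF J] _ a] T_R) auto
  also have "\<dots> \<subseteq> ipow ?J (n + 1)"
  proof (rule ipow_antimono[OF J])
    have "sum e B = (\<Sum>b\<in>B. p * (e b div p) + e b mod p)" by simp
    also have "\<dots> = p * (\<Sum>b\<in>B. e b div p) + (\<Sum>b\<in>B. e b mod p)"
      by (simp only: sum.distrib sum_distrib_left)
    also have "(\<Sum>b\<in>B. e b mod p) \<le> card B * (p - 1)"
    proof -
      have "e b mod p \<le> p - 1" for b using mod_less_divisor[OF p, of "e b"] by linarith
      then show ?thesis using sum_bounded_above[of B "\<lambda>b. e b mod p" "p - 1"] by simp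
    qed
    finally have "n * p < p * (\<Sum>b\<in>B. e b div p)" using e by linarith
    then have "n < (\<Sum>b\<in>B. e b div p)" by (metis mult.commute mult_less_cancel1)
    then show "n + 1 \<le> (\<Sum>b\<in>B. e b div p)" by simp
  qed
  finally show "T (c * (\<Prod>b\<in>B. \<gamma> b ^ e b)) \<in> ipow ?J (n + 1)" .
qed

end

subsection \<open>Minors of the generic symmetric matrix\<close>

interpretation sym: subdomain "sym_poly_ring r :: 'k::field ypoly set" for r
  by (rule subdomain_sym_poly_ring)

text \<open>The permutation sends i to the rank of \<open>u i\<close> in the image of
  \<open>u\<close>, which \<open>pick\<close> enumerates in increasing order.\<close>

lemma fminor_sort_rows:
  assumes inj: "inj_on u {..<k}"
  shows "\<exists>\<sigma>. fminor k A u v = signof \<sigma> * fminor k A (pick (u ` {..<k})) v"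
proof -
  define I where "I = u ` {..<k}"
  define \<sigma> where "\<sigma> i = (if i < k then card {a \<in> I. a < u i} else i)" for i
  have pick: "pick I (\<sigma> i) = u i" if "i < k" for i
    using that pick_card_in_set[of "u i" I] by (simp add: \<sigma>_def I_def)
  have lt: "\<sigma> i < k" if "i < k" for i
  proof -
    have "card {a \<in> I. a < u i} < card I"
      using that by (intro psubset_card_mono) (auto simp: I_def)
    then show ?thesis using that card_image[OF inj] by (simp add: \<sigma>_def I_def)
  qed
  have "inj_on \<sigma> {0..<k}"
    using inj pick by (intro inj_onI) (metis atLeastLessThan_iff inj_onD lessThan_iff)
  moreover have "\<sigma> ` {0..<k} \<subseteq> {0..<k}" using lt by auto
  ultimately have "bij_betw \<sigma> {0..<k} {0..<k}"
    by (simp add: bij_betw_def endo_inj_surj)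
  then have \<sigma>: "\<sigma> permutes {0..<k}" by (rule bij_imp_permutes) (simp add: \<sigma>_def)
  let ?B = "mat k k (\<lambda>(i, j). A (pick I i) (v j))"
  have "mat k k (\<lambda>(i, j). A (u i) (v j)) = mat k k (\<lambda>(i, j). ?B $$ (\<sigma> i, j))"
    using lt pick by (intro eq_matI) auto
  then have "fminor k A u v = signof \<sigma> * fminor k A (pick I) v"
    using det_permute_rows[of ?B k \<sigma>] \<sigma> by (simp add: fminor_def)
  then show ?thesis unfolding I_def by blast
qed

text \<open>A repeated row or column gives 0; distinct ones are sorted at the cost of a
  sign.\<close>

lemma fminor_minors:
  assumes M: "M \<in> carrier_mat m n" and u: "\<And>i. i < k \<Longrightarrow> u i < m" and v: "\<And>i. i < k \<Longrightarrow> v i < n"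
  shows "fminor k (\<lambda>i j. M $$ (i, j)) u v \<in> {0} \<union> minors k M \<union> uminus ` minors k M"
proof (cases "inj_on u {..<k} \<and> inj_on v {..<k}")
  case False
  then consider i j where "i < k" "j < k" "i \<noteq> j" "u i = u j" | i j where "i < k" "j < k" "i \<noteq> j" "v i = v j"
    by (auto simp: inj_on_def)
  then have "fminor k (\<lambda>i j. M $$ (i, j)) u v = 0"
  proof cases
    case 1
    then show ?thesis by (intro fminor_identical_rows[of i k j]) auto
  next
    case 2
    then show ?thesis by (subst fminor_transpose, intro fminor_identical_rows[of i k j]) auto
  qed
  then show ?thesis by simp
next
  case True
  let ?A = "\<lambda>i j. M $$ (i, j)"
  let ?I = "u ` {..<k}" and ?J = "v ` {..<k}"
  obtain \<sigma> where \<sigma>: "fminor k ?A u v = signof \<sigma> * fminor k ?A (pick ?I) v"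
    using fminor_sort_rows True by blast
  obtain \<tau> where "fminor k (\<lambda>i j. ?A j i) v (pick ?I) = signof \<tau> * fminor k (\<lambda>i j. ?A j i) (pick ?J) (pick ?I)"
    using fminor_sort_rows[of v k "\<lambda>i j. ?A j i" "pick ?I"] True by blast
  then have \<tau>: "fminor k ?A (pick ?I) v = signof \<tau> * fminor k ?A (pick ?I) (pick ?J)"
    by (simp add: fminor_transpose[of k ?A])
  have IJ: "?I \<subseteq> {..<m}" "?J \<subseteq> {..<n}" "card ?I = k" "card ?J = k"
    using u v True by (auto simp: card_image)
  have sub: "submatrix M ?I ?J = mat k k (\<lambda>(i, j). M $$ (pick ?I i, pick ?J j))"
  proof -
    have "{i. i < m \<and> i \<in> ?I} = ?I" "{i. i < n \<and> i \<in> ?J} = ?J" using IJ by auto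
    then show ?thesis using M IJ by (simp add: submatrix_def)
  qed
  have "?I \<subseteq> {..<dim_row M}" "?J \<subseteq> {..<dim_col M}" using M IJ by auto
  then have "det (submatrix M ?I ?J) \<in> minors k M" unfolding minors_def using IJ(3,4) by blast
  then have "fminor k ?A (pick ?I) (pick ?J) \<in> minors k M" by (simp add: sub fminor_def)
  then show ?thesis using \<sigma> \<tau> by (auto simp: sign_def)
qed

section \<open>Entries and minors of Y\<close>

definition yv :: "nat \<Rightarrow> nat \<Rightarrow> 'k::field ypoly" where
  "yv i j = indet (min i j, max i j)"

lemma yv_sym: "yv i j = yv j i"
  by (simp add: yv_def min.commute max.commute)

lemma yv_R [intro]: "i < r \<Longrightarrow> j < r \<Longrightarrow> yv i j \<in> sym_poly_ring r"
  unfolding yv_def by (intro indet_sym_poly_ring) auto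

lemma sym_mat_yv: "i < r \<Longrightarrow> j < r \<Longrightarrow> sym_mat r $$ (i, j) = yv i j"
  by (simp add: sym_mat_def yv_def)

lemma sym_mat_dim [simp]: "dim_row (sym_mat r) = r" "dim_col (sym_mat r) = r"
  by (simp_all add: sym_mat_def)

lemma sym_mat_carrier: "sym_mat r \<in> carrier_mat r r"
  by (simp add: sym_mat_def)

abbreviation into :: "nat \<Rightarrow> (nat \<Rightarrow> nat) \<Rightarrow> nat \<Rightarrow> bool" where
  "into k u r \<equiv> \<forall>i<k. u i < r"

lemma fminor_yv_R: "into k u r \<Longrightarrow> into k v r \<Longrightarrow> fminor k yv u v \<in> sym_poly_ring r"
  by (rule sym.fminor_R) auto

lemma minors_fminor:
  fixes x :: "'k::field ypoly"
  assumes "x \<in> minors k (sym_mat r)"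
  obtains u v where "into k u r" "into k v r" "x = fminor k yv u v"
proof -
  from assms obtain I J where IJ: "I \<subseteq> {..<r}" "J \<subseteq> {..<r}" "card I = k" "card J = k"
    and x: "x = det (submatrix (sym_mat r) I J)"
    by (auto simp: minors_def)
  have pick: "pick I i < r" "pick J i < r" if "i < k" for i
    using that IJ pick_in_set_le[of i I] pick_in_set_le[of i J] by auto
  have "{i. i < r \<and> i \<in> I} = I" "{i. i < r \<and> i \<in> J} = J" using IJ by auto
  then have "submatrix (sym_mat r) I J = (mat k k (\<lambda>(i, j). yv (pick I i) (pick J j)) :: 'k ypoly mat)"
    using IJ pick by (auto simp: submatrix_def sym_mat_yv intro!: eq_matI)
  then show ?thesis using x pick by (intro that[of "pick I" "pick J"]) (auto simp: fminor_def)
qed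

lemma minors_R: "minors k (sym_mat r) \<subseteq> sym_poly_ring r"
  by (auto elim!: minors_fminor intro: fminor_yv_R)

lemma ideal_sym_minor_ideal: "ideal (sym_minor_ideal r t) (ring_on (sym_poly_ring r))"
  unfolding sym_minor_ideal_def by (rule sym.ideal_Idl[OF minors_R])

lemma fminor_sym_minor_ideal:
  assumes "into t u r" "into t v r"
  shows "fminor t yv u v \<in> (sym_minor_ideal r t :: 'k::field ypoly set)"
proof -
  have "fminor t yv u v = (fminor t (\<lambda>i j. sym_mat r $$ (i, j)) u v :: 'k ypoly)"
    using assms by (intro fminor_cong) (simp add: sym_mat_yv)
  then have "(fminor t yv u v :: 'k ypoly) \<in> {0} \<union> minors t (sym_mat r) \<union> uminus ` minors t (sym_mat r)"
    using fminor_minors[OF sym_mat_carrier, of t u r v] assms by simp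
  moreover have "x \<in> sym_minor_ideal r t" if "x \<in> minors t (sym_mat r)" for x :: "'k ypoly"
    unfolding sym_minor_ideal_def by (rule sym.Idl_incl[OF minors_R that])
  ultimately show ?thesis
    by (auto simp: sym.ideal_0[OF ideal_sym_minor_ideal] sym.ideal_uminus[OF ideal_sym_minor_ideal])
qed

lemma sym_minor_ideal_minimal:
  assumes "ideal P (ring_on (sym_poly_ring r))"
    and "\<And>u v. into t u r \<Longrightarrow> into t v r \<Longrightarrow> fminor t yv u v \<in> P"
  shows "sym_minor_ideal r t \<subseteq> P"
  unfolding sym_minor_ideal_def
  by (rule sym.Idl_minimal[OF assms(1)]) (auto elim!: minors_fminor intro: assms(2))

subsection \<open>The generic symmetric matrix of rank \<open>s\<close>\<close>

text \<open>The indeterminates of Z and N are taken from one supply: even second indices serve Z,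
  odd ones serve the symmetric matrix N.\<close>

definition zv :: "nat \<Rightarrow> nat \<Rightarrow> 'k::field ypoly" where "zv i l = indet (i, 2 * l)"

definition nv :: "nat \<Rightarrow> nat \<Rightarrow> 'k::field ypoly" where "nv l m = indet (min l m, 2 * max l m + 1)"

text \<open>The entry of Z N Z^T, where Z has s columns.\<close>

definition gen :: "nat \<Rightarrow> nat \<Rightarrow> nat \<Rightarrow> 'k::field ypoly" where
  "gen s i j = (\<Sum>l<s. zv i l * (\<Sum>m<s. nv l m * zv j m))"

lemma nv_sym: "nv l m = nv m l"
  by (simp add: nv_def min.commute max.commute)

lemma gen_sym: "gen s i j = gen s j i"
proof -
  have "gen s i j = (\<Sum>l<s. \<Sum>m<s. zv i l * (nv l m * zv j m))"
    by (simp add: gen_def sum_distrib_left)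
  also have "\<dots> = (\<Sum>m<s. \<Sum>l<s. zv i l * (nv l m * zv j m))" by (rule sum.swap)
  also have "\<dots> = gen s j i"
    unfolding gen_def sum_distrib_left
    by (intro sum.cong refl) (simp add: nv_sym mult_ac)
  finally show ?thesis .
qed

definition gen_ev :: "nat \<Rightarrow> 'k::field ypoly \<Rightarrow> 'k ypoly" where
  "gen_ev s = ev (Poly_Mapping.single 0) (\<lambda>(i, j). gen s i j)"

lemma gen_ev_hom: "comm_ring_hom (gen_ev s :: 'k::field ypoly \<Rightarrow> 'k ypoly)"
  unfolding gen_ev_def by (rule comm_ring_hom.ev_hom[OF const_hom])

lemma gen_ev_yv: "gen_ev s (yv i j) = gen s i j"
  by (auto simp: gen_ev_def yv_def ev_indet[OF const_hom] min_def max_def gen_sym)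

definition gen_ideal :: "nat \<Rightarrow> nat \<Rightarrow> 'k::field ypoly set" where
  "gen_ideal r s = {q \<in> sym_poly_ring r. gen_ev s q = 0}"

lemma primeideal_gen_ideal: "primeideal (gen_ideal r s :: 'k::field ypoly set) (ring_on (sym_poly_ring r))"
proof -
  interpret comm_ring_hom "gen_ev s :: 'k ypoly \<Rightarrow> 'k ypoly" by (rule gen_ev_hom)
  show ?thesis
    unfolding sym.primeideal_ring_on_iff sym.ideal_ring_on_iff
    by (auto simp: gen_ideal_def hom_add hom_mult)
qed

lemma subdomain_UNIV: "subdomain UNIV"
  by unfold_locales auto

lemma gen_ev_fminor: "gen_ev s (fminor k yv u v) = fminor k (gen s) u v"
  by (simp add: fminor_hom[OF gen_ev_hom] gen_ev_yv)

text \<open>A matrix of rank s has perturbation 0, so the bound for perturbed minors, taken with the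
  zero ideal, puts the minor into a positive power of {0}.\<close>

lemma fminor_gen_eq_0:
  assumes "s < t"
  shows "fminor t (gen s :: nat \<Rightarrow> nat \<Rightarrow> 'k::field ypoly) u v = 0"
proof -
  interpret U: subdomain "UNIV :: 'k ypoly set" by (rule subdomain_UNIV)
  have zero: "ideal {0 :: 'k ypoly} (ring_on UNIV)" by (simp add: U.ideal_ring_on_iff)
  have "fminor t (gen s) u v = fminor t (\<lambda>i j. (\<Sum>l<s. zv (u i) l * (\<Sum>m<s. nv l m * zv (v j) m)) + 0 :: 'k ypoly) id id"
    by (simp add: fminor_def gen_def)
  also have "\<dots> \<in> U.ipow {0} (t - s)"
    by (rule U.fminor_rank_perturbation[OF zero]) auto
  also have "U.ipow {0} (t - s) \<subseteq> U.ipow {0} 1"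
    using assms by (intro U.ipow_antimono[OF zero]) simp
  also have "\<dots> \<subseteq> {0}"
    unfolding One_nat_def U.ipow_Suc
    using ring.ideal_prod_inter[OF U.ring_ring_on U.ideal_ipow[OF zero, of 0] zero] by auto
  finally show ?thesis by simp
qed

lemma sym_minor_ideal_gen_ideal: "s < t \<Longrightarrow> sym_minor_ideal r t \<subseteq> (gen_ideal r s :: 'k::field ypoly set)"
  using primeideal_gen_ideal[of r s, where 'k = 'k, unfolded sym.primeideal_ring_on_iff]
  by (intro sym_minor_ideal_minimal) (simp_all add: gen_ideal_def fminor_yv_R gen_ev_fminor fminor_gen_eq_0)

lemma fminor_notin_gen_ideal: "fminor s yv id id \<notin> (gen_ideal r s :: 'k::field ypoly set)"
proof
  assume "fminor s yv id id \<in> (gen_ideal r s :: 'k ypoly set)"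
  then have 0: "fminor s (gen s :: nat \<Rightarrow> nat \<Rightarrow> 'k ypoly) id id = 0"
    by (simp add: gen_ideal_def gen_ev_fminor)
  have idh: "comm_ring_hom (\<lambda>a :: 'k. a)" by unfold_locales auto
  \<comment> \<open>The condition i = j div 2 sets z_(i,i) and n_(l,l) to 1 and the other entries of
    Z and N to 0, so the upper left s-block of Z N Z^T becomes the identity.\<close>
  define h :: "'k ypoly \<Rightarrow> 'k" where "h = ev (\<lambda>a. a) (\<lambda>(i, j). if i = j div 2 then 1 else 0)"
  have h: "comm_ring_hom h" unfolding h_def by (rule comm_ring_hom.ev_hom[OF idh])
  interpret comm_ring_hom h by (rule h)
  have z: "h (zv i l) = (if i = l then 1 else 0)" for i l
    by (simp add: h_def zv_def ev_indet[OF idh])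
  have n: "h (nv l m) = (if l = m then 1 else 0)" for l m
    by (auto simp: h_def nv_def ev_indet[OF idh] min_def max_def)
  have inner: "(\<Sum>m<s. (if l = m then 1 else 0) * (if j = m then 1 else 0)) = (if j = l then 1 else (0 :: 'k))"
    if "j < s" for j l
  proof -
    have "(\<Sum>m<s. (if l = m then 1 else 0) * (if j = m then 1 else 0)) =
        (\<Sum>m<s. if j = m then (if j = l then 1 else 0) else (0 :: 'k))"
      by (rule sum.cong) auto
    then show ?thesis using that by simp
  qed
  have "h (gen s i j) = (if j = i then 1 else 0)" if "i < s" "j < s" for i j
    using that by (simp only: gen_def hom_sum hom_mult z n inner)
  then have "mat s s (\<lambda>(i, j). h (gen s (id i) (id j))) = 1\<^sub>m s"
    by (intro eq_matI) auto
  then have "h (fminor s (gen s) id id) = 1"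
    unfolding fminor_hom[OF h] by (simp add: fminor_def)
  then show False using 0 by simp
qed

section \<open>Homogeneous components\<close>

definition mdeg :: "('v \<Rightarrow>\<^sub>0 nat) \<Rightarrow> nat" where
  "mdeg m = (\<Sum>v\<in>Poly_Mapping.keys m. Poly_Mapping.lookup m v)"

text \<open>The degree d component of q, evaluated at x; for x = \<open>indet\<close> it is the
  component itself.\<close>

definition ev_deg :: "nat \<Rightarrow> (nat \<times> nat \<Rightarrow> 'k::field ypoly) \<Rightarrow> 'k ypoly \<Rightarrow> 'k ypoly" where
  "ev_deg d x q = (\<Sum>m | m \<in> Poly_Mapping.keys q \<and> mdeg m = d.
     Poly_Mapping.single 0 (Poly_Mapping.lookup q m) * power_prod x m)"

lemma prod_monom: "(\<Prod>v\<in>A. monom (f v) (e v)) = monom (prod f A) (sum e A)"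
  by (induction A rule: infinite_finite_induct) (simp_all add: mult_monom)

lemma power_prod_monom: "power_prod (\<lambda>v. monom (x v) 1) m = monom (power_prod x m) (mdeg m)"
  by (simp add: power_prod_def mdeg_def monom_power prod_monom)

lemma sum_monom: "(\<Sum>v\<in>A. monom (f v) n) = monom (sum f A) n"
  by (induction A rule: infinite_finite_induct) (simp_all add: add_monom)

lemma power_prod_scale: "power_prod (\<lambda>v. c * x v) m = c ^ mdeg m * power_prod x m"
  by (simp add: power_prod_def mdeg_def power_mult_distrib prod.distrib power_sum)

text \<open>Multiplying all values by an auxiliary variable sorts the terms of q by degree. If the
  resulting polynomial is 0, every component of q vanishes at x.\<close>

lemma coeff_ev_monom:
  "coeff (ev (\<lambda>a. [:Poly_Mapping.single 0 a:]) (\<lambda>v. monom (x v) 1) q) d = ev_deg d x q"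
proof -
  have "coeff ([:a:] * monom b n) d = (if n = d then a * b else 0)" for a b :: "'a ypoly" and n
    by (simp add: smult_monom)
  then show ?thesis
    unfolding ev_def power_prod_monom coeff_sum ev_deg_def by (simp only: sum.inter_filter finite_keys)
qed

lemma ev_deg_scale: "ev_deg d (\<lambda>v. c * x v) q = c ^ d * ev_deg d x q"
  unfolding ev_deg_def sum_distrib_left by (intro sum.cong) (auto simp: power_prod_scale)

lemma sum_ev_deg: "(\<Sum>d\<in>mdeg ` Poly_Mapping.keys q. ev_deg d indet q) = q"
proof -
  have "(\<Sum>d\<in>mdeg ` Poly_Mapping.keys q. ev_deg d indet q) = ev (Poly_Mapping.single 0) indet q"
    unfolding ev_deg_def ev_def by (rule sum.image_gen[symmetric]) simp
  then show ?thesis by (simp add: ev_id)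
qed

context subdomain begin

lemma power_prod_cong_ideal:
  assumes P: "ideal P (ring_on R)"
    and x: "\<And>v. v \<in> Poly_Mapping.keys m \<Longrightarrow> x v \<in> R" and y: "\<And>v. v \<in> Poly_Mapping.keys m \<Longrightarrow> y v \<in> R"
    and xy: "\<And>v. v \<in> Poly_Mapping.keys m \<Longrightarrow> x v - y v \<in> P"
  shows "power_prod x m - power_prod y m \<in> P"
proof -
  have mult: "a * c - b * d \<in> P" if "a - b \<in> P" "c - d \<in> P" "b \<in> R" "c \<in> R" for a b c d
  proof -
    have "a * c - b * d = c * (a - b) + b * (c - d)" by (simp add: algebra_simps)
    then show ?thesis using that ideal_add[OF P] ideal_lmult[OF P] by simp
  qed
  have pow: "a ^ n - b ^ n \<in> P" if "a - b \<in> P" "a \<in> R" "b \<in> R" for a b n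
    by (induction n) (use that ideal_0[OF P] in \<open>auto intro!: mult\<close>)
  have "(\<Prod>v\<in>A. x v ^ e v) - (\<Prod>v\<in>A. y v ^ e v) \<in> P" if "A \<subseteq> Poly_Mapping.keys m" for A e
    using that
  proof (induction A rule: infinite_finite_induct)
    case (insert v F)
    then show ?case using x y xy by (auto intro!: mult pow R_prod R_power)
  qed (auto simp: ideal_0[OF P])
  then show ?thesis by (simp add: power_prod_def)
qed

end

lemma ev_deg_cong_ideal:
  assumes P: "ideal P (ring_on (sym_poly_ring r))" and q: "q \<in> sym_poly_ring r"
    and x: "\<And>v. v \<in> sym_vars r \<Longrightarrow> x v \<in> sym_poly_ring r"
    and y: "\<And>v. v \<in> sym_vars r \<Longrightarrow> y v \<in> sym_poly_ring r"
    and xy: "\<And>v. v \<in> sym_vars r \<Longrightarrow> x v - y v \<in> P"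
  shows "ev_deg d x q - ev_deg d y q \<in> P"
proof -
  have "power_prod x m - power_prod y m \<in> P" if "m \<in> Poly_Mapping.keys q" for m
  proof (rule sym.power_prod_cong_ideal[OF P])
    fix v assume "v \<in> Poly_Mapping.keys m"
    then have "v \<in> sym_vars r" using that q unfolding sym_poly_ring_iff by blast
    then show "x v \<in> sym_poly_ring r" "y v \<in> sym_poly_ring r" "x v - y v \<in> P" using x y xy by blast+
  qed
  then show ?thesis
    unfolding ev_deg_def sum_subtractf[symmetric] right_diff_distrib[symmetric]
    by (intro sym.ideal_sum[OF P] sym.ideal_lmult[OF P] const_sym_poly_ring) auto
qed

text \<open>
  Modulo a prime containing the \<open>t\<close>-minors the generic symmetric matrix becomes, up to a
  nonzero factor \<open>\<delta>\<^sup>2\<close>, a specialization of the generic matrix of rank \<open>s = t - 1\<close>. The factor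
  is handled by scaling the middle matrix with a variable and comparing homogeneous components.
\<close>

lemma gen_ideal_subset_prime:
  fixes P :: "'k::field ypoly set"
  assumes prime: "primeideal P (ring_on (sym_poly_ring r))"
    and sub: "sym_minor_ideal r (Suc s) \<subseteq> P"
  shows "gen_ideal r s \<subseteq> P"
proof
  let ?R = "sym_poly_ring r :: 'k ypoly set"
  fix q :: "'k ypoly" assume "q \<in> gen_ideal r s"
  then have q: "q \<in> ?R" and q0: "gen_ev s q = 0" by (auto simp: gen_ideal_def)
  have P: "ideal P (ring_on ?R)" and one: "1 \<notin> P"
    and Pmult: "\<And>a b. a \<in> ?R \<Longrightarrow> b \<in> ?R \<Longrightarrow> a * b \<in> P \<Longrightarrow> a \<in> P \<or> b \<in> P"
    using prime unfolding sym.primeideal_ring_on_iff by auto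
  \<comment> \<open>The \<open>k\<close> obtained below is the rank of Y modulo \<open>P\<close>:
    all (k + 1)-minors lie in \<open>P\<close>, some k-minor \<delta> does not. It may be smaller
    than s.\<close>
  define A where "A k \<longleftrightarrow> (\<forall>u v. into k u r \<longrightarrow> into k v r \<longrightarrow> fminor k yv u v \<in> P)" for k
  have "A (Suc s)" using sub fminor_sym_minor_ideal unfolding A_def by blast
  moreover have "\<not> A 0" using one by (simp add: A_def fminor_def)
  ultimately obtain k where k: "k \<le> s" "\<not> A k" "A (Suc k)"
    using ex_least_nat_less[of A "Suc s"] by (auto simp: less_Suc_eq_le)
  then obtain u v where uv: "into k u r" "into k v r" and \<delta>P: "fminor k yv u v \<notin> P"
    by (auto simp: A_def)
  define \<delta> where "\<delta> = (fminor k yv u v :: 'k ypoly)"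
  have \<delta>R: "\<delta> \<in> ?R" unfolding \<delta>_def using uv by (rule fminor_yv_R)
  have \<delta>0: "\<delta> \<noteq> 0" using \<delta>P sym.ideal_0[OF P] unfolding \<delta>_def by metis
  define adj where "adj = adj_entry k (yv :: nat \<Rightarrow> nat \<Rightarrow> 'k ypoly) u v"
  have adjR: "adj l m \<in> ?R" if "l < k" "m < k" for l m
    unfolding adj_def using that uv by (intro sym.adj_entry_R) auto
  \<comment> \<open>Let C be the columns \<open>v\<close> of Y. Then W is the adjugate times the
    rows \<open>u\<close>, N = adj Y_(u,u) adj^T, and M = C N C^T. Modulo \<open>P\<close>,
    bordering gives \<delta> Y = C W, and with the symmetry of Y also \<delta> W = N C^T; hence
    \<delta>^2 Y = M.\<close>
  define W where "W l b = (\<Sum>m<k. adj l m * yv (u m) b)" for l b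
  define N where "N l l' = (\<Sum>m<k. \<Sum>m'<k. adj l m * adj l' m' * yv (u m) (u m'))" for l l'
  have NR: "N l l' \<in> ?R" if "l < k" "l' < k" for l l'
    unfolding N_def using that uv adjR by (intro sym.R_sum sym.R_mult) auto
  have N_sym: "N l l' = N l' l" for l l'
  proof -
    have "N l l' = (\<Sum>m'<k. \<Sum>m<k. adj l m * adj l' m' * yv (u m) (u m'))"
      unfolding N_def by (rule sum.swap)
    then show ?thesis by (simp add: N_def yv_sym mult_ac)
  qed
  define M where "M a b = (\<Sum>l<k. yv a (v l) * (\<Sum>l'<k. N l l' * yv b (v l')))" for a b
  have MR: "M a b \<in> ?R" if "a < r" "b < r" for a b
    unfolding M_def using that uv NR by (intro sym.R_sum sym.R_mult) auto
  define e where "e a b = \<delta> * yv a b - (\<Sum>l<k. yv a (v l) * W l b)" for a b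
  have e: "e a b \<in> P" if "a < r" "b < r" for a b
  proof -
    have "e a b = fminor (Suc k) yv (u(k := a)) (v(k := b))"
      using fminor_bordered[of k "yv :: nat \<Rightarrow> nat \<Rightarrow> 'k ypoly" u v a b] \<delta>0 by (simp add: e_def \<delta>_def W_def adj_def)
    also have "\<dots> \<in> P" using k(3) uv that unfolding A_def by (auto simp: less_Suc_eq)
    finally show ?thesis .
  qed
  have W: "\<delta> * W l b - (\<Sum>l'<k. N l l' * yv b (v l')) \<in> P" if "l < k" "b < r" for l b
  proof -
    have "\<delta> * W l b = (\<Sum>m<k. adj l m * (\<delta> * yv b (u m)))"
      by (simp add: W_def sum_distrib_left yv_sym mult_ac)
    also have "\<dots> = (\<Sum>m<k. adj l m * e b (u m)) + (\<Sum>m<k. adj l m * (\<Sum>l'<k. yv b (v l') * W l' (u m)))"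
      by (simp add: e_def right_diff_distrib flip: sum.distrib)
    also have "(\<Sum>m<k. adj l m * (\<Sum>l'<k. yv b (v l') * W l' (u m))) =
        (\<Sum>m<k. \<Sum>l'<k. adj l m * (yv b (v l') * W l' (u m)))"
      by (simp add: sum_distrib_left)
    also have "\<dots> = (\<Sum>l'<k. \<Sum>m<k. adj l m * (yv b (v l') * W l' (u m)))" by (rule sum.swap)
    also have "\<dots> = (\<Sum>l'<k. N l l' * yv b (v l'))"
      unfolding N_def W_def sum_distrib_left sum_distrib_right
      by (intro sum.cong refl) (simp add: yv_sym mult_ac)
    finally have "\<delta> * W l b - (\<Sum>l'<k. N l l' * yv b (v l')) = (\<Sum>m<k. adj l m * e b (u m))" by simp
    also have "\<dots> \<in> P" using that uv e adjR by (intro sym.ideal_sum[OF P] sym.ideal_lmult[OF P]) auto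
    finally show ?thesis .
  qed
  have M: "\<delta>\<^sup>2 * yv a b - M a b \<in> P" if "a < r" "b < r" for a b
  proof -
    have "\<delta>\<^sup>2 * yv a b - M a b =
        \<delta> * e a b + (\<Sum>l<k. yv a (v l) * (\<delta> * W l b - (\<Sum>l'<k. N l l' * yv b (v l'))))"
    proof -
      have "(\<Sum>l<k. yv a (v l) * (\<delta> * W l b - (\<Sum>l'<k. N l l' * yv b (v l')))) =
          \<delta> * (\<Sum>l<k. yv a (v l) * W l b) - M a b"
        by (simp add: M_def right_diff_distrib sum_subtractf sum_distrib_left[of \<delta>] mult.left_commute)
      then show ?thesis by (simp add: e_def power2_eq_square right_diff_distrib mult.assoc)
    qed
    also have "\<dots> \<in> P"
      using that uv e W \<delta>R
      by (intro sym.ideal_add[OF P] sym.ideal_sum[OF P] sym.ideal_lmult[OF P]) auto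
    finally show ?thesis .
  qed
  define c where "c a = [:Poly_Mapping.single 0 a :: 'k ypoly:]" for a
  have c: "comm_ring_hom c"
    by unfold_locales (simp_all add: c_def single_add mult_single one_pCons mult.commute)
  \<comment> \<open>Z is specialized to C, padded with zero columns from k to s, and N to the matrix
    \<open>N\<close> times a new variable. The generic matrix then becomes M times that variable, so
    every homogeneous component of q vanishes at M.\<close>
  define x where "x = (\<lambda>(i, j). if even j then monom (if j div 2 < k then yv i (v (j div 2)) else 0) 0
    else monom (N i (j div 2)) 1)"
  define h where "h = ev c x"
  have h: "comm_ring_hom h" unfolding h_def by (rule comm_ring_hom.ev_hom[OF c])
  interpret h: comm_ring_hom h by (rule h)
  have hz: "h (zv i l) = monom (if l < k then yv i (v l) else 0) 0" for i l
    by (simp add: h_def zv_def ev_indet[OF c] x_def)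
  have hn: "h (nv l m) = monom (N l m) 1" for l m
    by (auto simp: h_def nv_def ev_indet[OF c] x_def min_def max_def N_sym)
  have hgen: "h (gen s i j) = monom (M i j) 1" for i j
  proof -
    have trunc: "(\<Sum>l<s. if l < k then f l else 0) = (\<Sum>l<k. f l)" for f :: "nat \<Rightarrow> 'k ypoly"
      using k(1) by (simp add: sum.If_cases Int_def) (intro sum.cong, auto)
    have "h (gen s i j) = (\<Sum>l<s. monom (if l < k then yv i (v l) else 0) 0 *
        (\<Sum>m<s. monom (N l m) 1 * monom (if m < k then yv j (v m) else 0) 0))"
      by (simp add: gen_def h.hom_sum h.hom_mult hz hn)
    also have "\<dots> = monom (\<Sum>l<s. (if l < k then yv i (v l) else 0) * (\<Sum>m<s. N l m * (if m < k then yv j (v m) else 0))) 1"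
      by (simp only: mult_monom sum_monom add_0 add_0_right)
    also have "(\<Sum>l<s. (if l < k then yv i (v l) else 0) * (\<Sum>m<s. N l m * (if m < k then yv j (v m) else 0))) = M i j"
      unfolding M_def by (simp add: if_distrib[of "\<lambda>x. x * _"] if_distrib[of "\<lambda>x. _ * x"] trunc cong: if_cong)
    finally show ?thesis .
  qed
  have "0 = h (gen_ev s q)" using q0 by simp
  also have "\<dots> = ev (\<lambda>a. h (Poly_Mapping.single 0 a)) (\<lambda>v. h (case v of (i, j) \<Rightarrow> gen s i j)) q"
    unfolding gen_ev_def by (rule hom_ev[OF h])
  also have "(\<lambda>a. h (Poly_Mapping.single 0 a)) = (\<lambda>a. [:Poly_Mapping.single 0 a:])"
    by (simp add: h_def comm_ring_hom.ev_single[OF c] fun_eq_iff c_def)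
  also have "(\<lambda>v. h (case v of (i, j) \<Rightarrow> gen s i j)) = (\<lambda>v. monom (case v of (i, j) \<Rightarrow> M i j) 1)"
    by (simp add: fun_eq_iff hgen)
  finally have comp: "ev_deg d (\<lambda>(i, j). M i j) q = 0" for d
    by (metis coeff_0 coeff_ev_monom)
  have "ev_deg d indet q \<in> P" for d
  proof -
    have ind: "indet (i, j) = yv i j" if "i \<le> j" for i j using that by (simp add: yv_def)
    \<comment> \<open>Modulo \<open>P\<close> the values at \<delta>^2 Y and at M agree, and the
      latter is 0. Homogeneity turns \<delta>^2 into the factor \<delta>^(2d), which can be removed
      because \<open>P\<close> is prime and avoids \<delta>.\<close>
    have "ev_deg d (\<lambda>v. \<delta>\<^sup>2 * indet v) q - ev_deg d (\<lambda>(i, j). M i j) q \<in> P"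
      by (rule ev_deg_cong_ideal[OF P q]) (use M MR \<delta>R in \<open>auto simp: ind intro!: sym.R_mult sym.R_power yv_R\<close>)
    then have 1: "\<delta> ^ (2 * d) * ev_deg d indet q \<in> P"
      by (simp add: comp ev_deg_scale power_mult)
    have "ev_deg d indet q \<in> ?R"
      unfolding ev_deg_def power_prod_def
    proof (intro sym.R_sum sym.R_mult sym.R_prod sym.R_power const_sym_poly_ring indet_sym_poly_ring)
      fix m v assume "m \<in> {m. m \<in> Poly_Mapping.keys q \<and> mdeg m = d}" "v \<in> Poly_Mapping.keys m"
      then show "v \<in> sym_vars r" using q unfolding sym_poly_ring_iff by blast
    qed
    then have "\<delta> ^ n * ev_deg d indet q \<in> P \<Longrightarrow> ev_deg d indet q \<in> P" for n
    proof (induction n)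
      case (Suc n)
      then show ?case
        using Pmult[of \<delta> "\<delta> ^ n * ev_deg d indet q"] \<delta>R \<delta>P
        by (auto simp: \<delta>_def mult.assoc intro!: sym.R_mult sym.R_power)
    qed simp
    then show ?thesis using 1 by blast
  qed
  then have "(\<Sum>d\<in>mdeg ` Poly_Mapping.keys q. ev_deg d indet q) \<in> P"
    by (intro sym.ideal_sum[OF P])
  then show "q \<in> P" by (simp add: sum_ev_deg)
qed

text \<open>The kernel is a prime containing the ideal and lies in every such prime.\<close>

lemma minimal_primes_sym_minor_ideal:
  "minimal_primes (ring_on (sym_poly_ring r)) (sym_minor_ideal r (Suc s)) = {gen_ideal r s :: 'k::field ypoly set}"
  using gen_ideal_subset_prime[of _ r s] primeideal_gen_ideal[of r s] sym_minor_ideal_gen_ideal[of s "Suc s" r]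
  unfolding minimal_primes_def by blast

subsection \<open>The product of the minors along the diagonals\<close>

text \<open>Twice the difference of the two sums is the sum of the squares (i - \<sigma> i)^2,
  because \<sigma> preserves the sums of i and of i^2. For \<sigma> other than the identity some
  square is positive.\<close>

lemma rearrangement_identity:
  fixes c :: nat
  assumes \<sigma>: "\<sigma> permutes {0..<k}" and "\<sigma> \<noteq> id"
  shows "(\<Sum>i<k. Suc i * Suc (c + \<sigma> i)) < (\<Sum>i<k. Suc i * Suc (c + i))"
proof -
  have perm: "(\<Sum>i<k. g (\<sigma> i)) = (\<Sum>i<k. g i)" for g :: "nat \<Rightarrow> int"
    using sum.permute[OF \<sigma>, of g] by (simp add: atLeast0LessThan comp_def)
  obtain j where j: "\<sigma> j \<noteq> j" using \<open>\<sigma> \<noteq> id\<close> by (auto simp: fun_eq_iff)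
  then have "j < k" using permutes_not_in[OF \<sigma>, of j] by fastforce
  then have "0 < (\<Sum>i<k. (int i - int (\<sigma> i))\<^sup>2)"
    using j by (intro sum_pos2[of _ j]) auto
  also have "\<dots> = (\<Sum>i<k. 2 * int (Suc i * Suc (c + i)) - 2 * int (Suc i * Suc (c + \<sigma> i))
      + ((int (\<sigma> i))\<^sup>2 - (int i)\<^sup>2) + 2 * (int (\<sigma> i) - int i))"
    by (rule sum.cong) (simp_all add: power2_eq_square algebra_simps)
  also have "\<dots> = 2 * (\<Sum>i<k. int (Suc i * Suc (c + i))) - 2 * (\<Sum>i<k. int (Suc i * Suc (c + \<sigma> i)))"
    using perm[of "\<lambda>i. (int i)\<^sup>2"] perm[of int]
    by (simp only: sum.distrib sum_subtractf sum_distrib_left[symmetric] diff_self mult_zero_right add_0_right)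
  finally have "(\<Sum>i<k. int (Suc i * Suc (c + \<sigma> i))) < (\<Sum>i<k. int (Suc i * Suc (c + i)))" by simp
  then show ?thesis by (simp only: of_nat_sum[symmetric] of_nat_less_iff)
qed

text \<open>The diagonal of this minor is the (r - k)-th superdiagonal of Y; as k varies, these
  cover each variable once.\<close>

definition diag_minor :: "nat \<Rightarrow> nat \<Rightarrow> 'k::field ypoly" where
  "diag_minor r k = fminor k yv id (\<lambda>j. r - k + j)"

definition diag_mon :: "nat \<Rightarrow> nat \<Rightarrow> (nat \<times> nat) \<Rightarrow>\<^sub>0 nat" where
  "diag_mon r k = (\<Sum>i<k. Poly_Mapping.single (i, r - k + i) 1)"

text \<open>Symmetry in the indices makes the weight independent of which of y_(i,j) and y_(j,i) is
  written; the product form lets the rearrangement inequality single out the diagonal.\<close>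

definition index_weight :: "nat \<times> nat \<Rightarrow> nat" where
  "index_weight v = Suc (fst v) * Suc (snd v)"

lemma prod_yv:
  "(\<Prod>i\<in>A. yv (f i) (g i)) =
    (Poly_Mapping.single (\<Sum>i\<in>A. Poly_Mapping.single (min (f i) (g i), max (f i) (g i)) 1) 1 :: 'k::field ypoly)"
  by (induction A rule: infinite_finite_induct) (simp_all add: yv_def indet_def mult_single)

text \<open>Among the Leibniz terms the identity has strictly the largest weight. Other terms may
  coincide or cancel by the symmetry of Y, without harm.\<close>

lemma lead_diag_minor:
  assumes "k \<le> r"
  shows "lead index_weight (diag_minor r k :: 'k::field ypoly) (diag_mon r k)"
proof -
  define m where "m \<sigma> = (\<Sum>i<k. Poly_Mapping.single (min i (r - k + \<sigma> i), max i (r - k + \<sigma> i)) (1::nat))"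
    for \<sigma> :: "nat \<Rightarrow> nat"
  define g where "g = (\<Sum>\<sigma> | \<sigma> permutes {0..<k} \<and> \<sigma> \<noteq> id. (signof \<sigma> * Poly_Mapping.single (m \<sigma>) 1 :: 'k ypoly))"
  have wt: "wt index_weight (m \<sigma>) = (\<Sum>i<k. Suc i * Suc (r - k + \<sigma> i))" for \<sigma>
    unfolding m_def wt_sum
    by (intro sum.cong refl) (simp add: index_weight_def min_def max_def mult.commute)
  have id: "m id = diag_mon r k" by (simp add: m_def diag_mon_def)
  have "diag_minor r k = (\<Sum>\<sigma> | \<sigma> permutes {0..<k}. (signof \<sigma> * Poly_Mapping.single (m \<sigma>) 1 :: 'k ypoly))"
    unfolding diag_minor_def fminor_leibniz prod_yv m_def by (simp add: atLeast0LessThan)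
  also have "\<dots> = signof id * Poly_Mapping.single (m id) 1 + g"
  proof -
    have "{\<sigma>. \<sigma> permutes {0..<k}} = insert id {\<sigma>. \<sigma> permutes {0..<k} \<and> \<sigma> \<noteq> id}"
      using permutes_id by auto
    moreover have "finite {\<sigma>. \<sigma> permutes {0..<k} \<and> \<sigma> \<noteq> id}"
      using finite_permutations[of "{0..<k}"] by (rule rev_finite_subset) auto
    ultimately show ?thesis by (simp add: g_def)
  qed
  finally have "diag_minor r k = Poly_Mapping.single (diag_mon r k) 1 + g"
    by (simp add: id sign_id)
  moreover have "wt index_weight l < wt index_weight (diag_mon r k)" if "l \<in> Poly_Mapping.keys g" for l
  proof -
    have "\<exists>\<sigma>. \<sigma> permutes {0..<k} \<and> \<sigma> \<noteq> id \<and> Poly_Mapping.lookup (signof \<sigma> * Poly_Mapping.single (m \<sigma>) (1 :: 'k)) l \<noteq> 0"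
      using that unfolding g_def in_keys_iff lookup_sum by (auto elim: sum.not_neutral_contains_not_neutral)
    then obtain \<sigma> where \<sigma>: "\<sigma> permutes {0..<k}" "\<sigma> \<noteq> id" "l = m \<sigma>"
      by (auto simp: sign_def lookup_single when_def split: if_splits)
    then show ?thesis
      using rearrangement_identity[of \<sigma> k "r - k"] by (simp add: wt flip: id)
  qed
  ultimately show ?thesis unfolding lead_def by blast
qed

definition diag_prod :: "nat \<Rightarrow> 'k::field ypoly" where
  "diag_prod r = (\<Prod>k\<in>{1..r}. diag_minor r k)"

lemma lead_diag_prod: "lead index_weight (diag_prod r :: 'k::field ypoly) (\<Sum>k\<in>{1..r}. diag_mon r k)"
  unfolding diag_prod_def by (rule lead_prod) (simp add: lead_diag_minor)

text \<open>A variable at (a, b) lies on a single superdiagonal, so only k = r + a - b can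
  contribute, and at most once.\<close>

lemma lookup_sum_diag_mon: "Poly_Mapping.lookup (\<Sum>k\<in>{1..r}. diag_mon r k) v \<le> 1"
proof -
  obtain a b where v: "v = (a, b)" by (cases v)
  have "Poly_Mapping.lookup (diag_mon r k) v \<le> (if k = r + a - b then 1 else 0)" if "k \<in> {1..r}" for k
  proof -
    have "Poly_Mapping.lookup (diag_mon r k) v = (\<Sum>i<k. if i = a then (if r - k + a = b then 1 else 0) else 0)"
      unfolding diag_mon_def lookup_sum v by (intro sum.cong) (auto simp: lookup_single when_def)
    also have "\<dots> \<le> (if r - k + a = b then 1 else 0)" by simp
    also have "\<dots> \<le> (if k = r + a - b then 1 else 0)" using that by auto
    finally show ?thesis .
  qed
  then have "Poly_Mapping.lookup (\<Sum>k\<in>{1..r}. diag_mon r k) v \<le> (\<Sum>k\<in>{1..r}. if k = r + a - b then 1 else 0)"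
    unfolding lookup_sum by (rule sum_mono)
  also have "\<dots> \<le> 1" by simp
  finally show ?thesis .
qed

lemma diag_minor_R: "k \<le> r \<Longrightarrow> diag_minor r k \<in> sym_poly_ring r"
  unfolding diag_minor_def by (rule fminor_yv_R) auto

lemma diag_prod_R: "diag_prod r \<in> sym_poly_ring r"
  unfolding diag_prod_def by (intro sym.R_prod diag_minor_R) auto

subsection \<open>The bordered minors\<close>

abbreviation pivot :: "nat \<Rightarrow> 'k::field ypoly" where
  "pivot s \<equiv> fminor s yv id id"

definition bordered :: "nat \<Rightarrow> nat \<times> nat \<Rightarrow> 'k::field ypoly" where
  "bordered s = (\<lambda>(a, b). fminor (Suc s) yv (id(s := a)) (id(s := b)))"

text \<open>These pairs suffice: Y is symmetric, and an index below s repeats a row or column of the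
  pivot, so that the bordered minor is 0.\<close>

definition border :: "nat \<Rightarrow> nat \<Rightarrow> (nat \<times> nat) set" where
  "border r s = {(a, b). s \<le> a \<and> a \<le> b \<and> b < r}"

lemma border_Sigma: "border r s = (\<lambda>(b, a). (a, b)) ` (SIGMA b:{..<r}. {s..b})"
  by (auto simp: border_def image_iff)

lemma finite_border [simp]: "finite (border r s)"
  unfolding border_Sigma by simp

text \<open>Counted by columns b, with k = b + 1. The terms k - s are also the orders of the factors
  of \<open>diag_prod\<close>, and this agreement is what the pigeonhole argument requires.\<close>

lemma card_border: "card (border r s) = (\<Sum>k\<in>{1..r}. k - s)"
proof -
  have "card (border r s) = card (SIGMA b:{..<r}. {s..b})"
    unfolding border_Sigma by (rule card_image) (auto simp: inj_on_def)
  also have "\<dots> = (\<Sum>b<r. Suc b - s)" by simp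
  also have "\<dots> = (\<Sum>k\<in>{1..r}. k - s)"
    by (rule sum.reindex_bij_witness[of _ "\<lambda>k. k - 1" Suc]) auto
  finally show ?thesis .
qed

lemma bordered_sym_minor_ideal:
  assumes "s < r" "a < r" "b < r"
  shows "bordered s (a, b) \<in> sym_minor_ideal r (Suc s)"
  unfolding bordered_def prod.case
  by (rule fminor_sym_minor_ideal) (use assms in \<open>auto simp: less_Suc_eq\<close>)

abbreviation border_ideal :: "nat \<Rightarrow> nat \<Rightarrow> 'k::field ypoly set" where
  "border_ideal r s \<equiv> Idl\<^bsub>ring_on (sym_poly_ring r)\<^esub> (bordered s ` border r s)"

lemma bordered_R: "s < r \<Longrightarrow> v \<in> border r s \<Longrightarrow> bordered s v \<in> sym_poly_ring r"
  by (auto simp: border_def intro!: sym.ideal_sub[OF ideal_sym_minor_ideal bordered_sym_minor_ideal])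

lemma ideal_border_ideal: "s < r \<Longrightarrow> ideal (border_ideal r s :: 'k::field ypoly set) (ring_on (sym_poly_ring r))"
  by (rule sym.ideal_Idl) (auto intro: bordered_R)

lemma border_ideal_subset: "s < r \<Longrightarrow> border_ideal r s \<subseteq> sym_minor_ideal r (Suc s)"
  by (rule sym.Idl_minimal[OF ideal_sym_minor_ideal])
    (auto simp: border_def intro!: bordered_sym_minor_ideal)

lemma bordered_border_ideal:
  assumes "s < r" "a < r" "b < r"
  shows "bordered s (a, b) \<in> (border_ideal r s :: 'k::field ypoly set)"
proof -
  let ?J = "border_ideal r s :: 'k ypoly set"
  have comm: "bordered s (a, b) = (bordered s (b, a) :: 'k ypoly)" for a b
    unfolding bordered_def prod.case
    by (subst fminor_transpose) (simp add: fminor_def yv_sym)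
  have zero: "bordered s (a, b) = (0 :: 'k ypoly)" if "a < s" for a b
    unfolding bordered_def prod.case
    by (rule fminor_identical_rows[of a _ s]) (use that in auto)
  have *: "bordered s (a, b) \<in> ?J" if "a \<le> b" "b < r" for a b
  proof (cases "s \<le> a")
    case True
    then show ?thesis
      using that assms(1) by (intro sym.Idl_incl) (auto simp: border_def intro!: bordered_R)
  next
    case False
    then show ?thesis using zero sym.ideal_0[OF ideal_border_ideal[OF assms(1)]] by simp
  qed
  show ?thesis
    using *[of a b] *[of b a] comm[of a b] assms by (cases "a \<le> b") auto
qed

text \<open>\<open>fminor_pow_ipow\<close> for the upper left s-minor, which is nonzero because it
  lies outside \<open>gen_ideal\<close>.\<close>

lemma pivot_pow_fminor:
  assumes "s < r" "into k u r" "into k v r"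
  shows "pivot s ^ k * fminor k yv u v \<in> sym.ipow r (border_ideal r s :: 'k::field ypoly set) (k - s)"
proof (rule sym.fminor_pow_ipow[OF ideal_border_ideal[OF assms(1)]])
  have "0 \<in> (gen_ideal r s :: 'k ypoly set)"
    using primeideal_gen_ideal sym.ideal_0 sym.primeideal_ring_on_iff by blast
  then show "pivot s \<noteq> (0 :: 'k ypoly)" using fminor_notin_gen_ideal[of s r, where 'k = 'k] by metis
  show "fminor (Suc s) yv (id(s := a)) (id(s := b)) \<in> (border_ideal r s :: 'k ypoly set)" if "a < r" "b < r" for a b
    using bordered_border_ideal[OF assms(1) that] by (simp add: bordered_def)
qed (use assms in auto)

text \<open>For minors of size s + 1 the exponent k - s is 1. The elements carried into the border
  ideal by the power of the pivot form an ideal, so checking minors is enough.\<close>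

lemma pivot_pow_sym_minor_ideal:
  assumes "s < r" "x \<in> (sym_minor_ideal r (Suc s) :: 'k::field ypoly set)"
  shows "pivot s ^ Suc s * x \<in> border_ideal r s"
proof -
  let ?J = "border_ideal r s :: 'k ypoly set"
  note J = ideal_border_ideal[OF assms(1)]
  have \<Delta>: "pivot s ^ Suc s \<in> (sym_poly_ring r :: 'k ypoly set)"
    using assms(1) by (intro sym.R_power fminor_yv_R) auto
  define K where "K = {x \<in> sym_poly_ring r. pivot s ^ Suc s * x \<in> ?J}"
  have "ideal K (ring_on (sym_poly_ring r))"
    unfolding sym.ideal_ring_on_iff
    using sym.ideal_0[OF J] sym.ideal_add[OF J] sym.ideal_lmult[OF J]
    by (auto simp: K_def distrib_left mult.left_commute[of "pivot s ^ Suc s"] simp del: power_Suc)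
  then have "sym_minor_ideal r (Suc s) \<subseteq> K"
  proof (rule sym_minor_ideal_minimal)
    fix u v assume uv: "into (Suc s) u r" "into (Suc s) v r"
    have "sym.ipow r ?J (Suc 0) \<subseteq> ?J"
      unfolding sym.ipow_Suc
      using ring.ideal_prod_inter[OF sym.ring_ring_on sym.ideal_ipow[OF J, of 0] J] by auto
    then have "pivot s ^ Suc s * fminor (Suc s) yv u v \<in> ?J"
      using pivot_pow_fminor[OF assms(1) uv, where 'k = 'k] by (auto simp del: power_Suc)
    then show "fminor (Suc s) yv u v \<in> K" using uv by (simp add: K_def fminor_yv_R)
  qed
  then show ?thesis using assms(2) by (auto simp: K_def)
qed

text \<open>The k-th factor takes k copies of the pivot and has order k - s; the orders add up to
  the number of generators.\<close>

lemma pivot_pow_diag_prod: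
  assumes "s < r"
  shows "pivot s ^ (\<Sum>{1..r}) * diag_prod r \<in> sym.ipow r (border_ideal r s :: 'k::field ypoly set) (card (border r s))"
proof -
  have "pivot s ^ (\<Sum>{1..r}) * diag_prod r = (\<Prod>k\<in>{1..r}. pivot s ^ k * diag_minor r k :: 'k ypoly)"
    by (simp add: diag_prod_def power_sum prod.distrib)
  also have "\<dots> \<in> sym.ipow r (border_ideal r s) (card (border r s))"
    unfolding card_border
  proof (rule sym.ipow_prod[OF ideal_border_ideal[OF assms]])
    fix k assume "k \<in> {1..r}"
    then show "pivot s ^ k * diag_minor r k \<in> sym.ipow r (border_ideal r s :: 'k ypoly set) (k - s)"
      unfolding diag_minor_def by (intro pivot_pow_fminor assms) auto
  qed
  finally show ?thesis .
qed

section \<open>The Frobenius splitting for the ideal of minors\<close>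

lemma (in subdomain) ipow_mono:
  assumes "ideal I (ring_on R)" "ideal J (ring_on R)" "J \<subseteq> I"
  shows "ipow J n \<subseteq> ipow I n"
  using mult_pow_ipow[OF assms(2,1), of 1] assms(3) by auto

lemma frobenius_section_sym_minor_ideal:
  assumes sr: "s < r" and p: "prime p" and CHAR: "CHAR('k::field) = p"
  shows "\<exists>T. frobenius_section (sym_poly_ring r :: 'k ypoly set) (sym_minor_ideal r (Suc s)) p T"
proof -
  let ?R = "sym_poly_ring r :: 'k ypoly set" and ?I = "sym_minor_ideal r (Suc s) :: 'k ypoly set"
  let ?J = "border_ideal r s :: 'k ypoly set" and ?F = "diag_prod r ^ (p - 1) :: 'k ypoly"
  let ?\<Delta> = "pivot s :: 'k ypoly"
  note J = ideal_border_ideal[OF sr, where 'k = 'k]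
  have proper: "proper_ideal ?R ?I"
    by (intro proper_ideal.intro proper_ideal_axioms.intro subdomain_sym_poly_ring)
      (simp_all add: ideal_sym_minor_ideal minimal_primes_sym_minor_ideal)
  interpret proper_ideal ?R ?I by (rule proper)
  have \<Delta>R: "?\<Delta> \<in> ?R" using sr by (intro fminor_yv_R) auto
  have \<Delta>S: "?\<Delta> \<in> S"
    using \<Delta>R fminor_notin_gen_ideal[of s r, where 'k = 'k]
    by (simp add: S_def minimal_primes_sym_minor_ideal)
  obtain \<theta> :: "'k \<Rightarrow> 'k" where \<theta>: "\<And>x y. \<theta> (x + y) = \<theta> x + \<theta> y" "\<And>a x. \<theta> (a ^ p * x) = a * \<theta> x" "\<theta> 1 = 1"
    using ex_frobenius_section_field[OF p CHAR] by blast
  \<comment> \<open>The leading exponent of \<open>?F\<close>, so that the trace of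
    \<open>?F\<close> is 1.\<close>
  define ob where "ob = smul (p - 1) (\<Sum>k\<in>{1..r}. diag_mon r k)"
  have p_pos: "p > 0" using p prime_gt_0_nat by blast
  interpret poly_trace p \<theta> ob
  proof
    fix v
    have "(p - 1) * Poly_Mapping.lookup (\<Sum>k\<in>{1..r}. diag_mon r k) v \<le> (p - 1) * 1"
      by (rule mult_le_mono2[OF lookup_sum_diag_mon])
    then have "Poly_Mapping.lookup ob v \<le> p - 1" by (simp only: ob_def lookup_smul mult_1_right)
    then show "Poly_Mapping.lookup ob v < p" using p_pos by linarith
  qed (use p CHAR \<theta> in auto)
  have Tr_R: "Tr f \<in> ?R" if "f \<in> ?R" for f
    unfolding sym_poly_ring_iff
  proof
    fix n assume "n \<in> Poly_Mapping.keys (Tr f)"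
    then have "Poly_Mapping.keys (smul p n + ob) \<subseteq> sym_vars r"
      using keys_Tr that unfolding sym_poly_ring_iff by blast
    moreover have "Poly_Mapping.keys n \<subseteq> Poly_Mapping.keys (smul p n + ob)"
      using p_pos by (auto simp: in_keys_iff lookup_add)
    ultimately show "Poly_Mapping.keys n \<subseteq> sym_vars r" by blast
  qed
  have F_R: "?F \<in> ?R" by (intro sym.R_power diag_prod_R)
  have Tr_F: "Tr ?F = 1"
    by (rule Tr_lead[of index_weight, OF _ lead_power[OF lead_diag_prod, of r "p - 1", folded ob_def]])
      (simp add: index_weight_def)
  define c where "c = \<Sum>{1..r} * (p - 1)"
  have F: "?\<Delta> ^ c * ?F \<in> sym.ipow r ?J (card (border r s) * (p - 1))"
    using sym.ipow_power[OF J pivot_pow_diag_prod[OF sr], of "p - 1"]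
    by (simp add: c_def power_mult_distrib power_mult)
  \<comment> \<open>The factor \<open>?F\<close> both normalizes the trace and, up to powers of the
    pivot, raises the order along \<open>?J\<close> by p - 1 times the number of generators.\<close>
  have "frobenius_section ?R ?I p (\<lambda>x. Tr (?F * x))"
  proof (rule frobenius_section.intro[OF proper], rule frobenius_section_axioms.intro)
    fix x n assume "x \<in> sp (n * p + 1)"
    then obtain \<sigma> where x: "x \<in> ?R" and \<sigma>: "\<sigma> \<in> S" and \<sigma>x: "\<sigma> * x \<in> sym.ipow r ?I (n * p + 1)"
      unfolding sp_iff by blast
    \<comment> \<open>Each of the n p + 1 factors from \<open>?I\<close> takes s + 1 copies of the
      pivot to get into \<open>?J\<close>.\<close>
    define d where "d = Suc s * (n * p + 1)"
    have "(?\<Delta> ^ Suc s) ^ (n * p + 1) * (\<sigma> * x) \<in> sym.ipow r ?J (n * p + 1)"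
      by (rule sym.mult_pow_ipow[OF I J sym.R_power[OF \<Delta>R] pivot_pow_sym_minor_ideal[OF sr] \<sigma>x])
    then have "?\<Delta> ^ d * (\<sigma> * x) \<in> sym.ipow r ?J (n * p + 1)" by (simp only: d_def power_mult)
    then have prod: "(?\<Delta> ^ d * (\<sigma> * x)) * (?\<Delta> ^ c * ?F) \<in> sym.ipow r ?J (n * p + 1 + card (border r s) * (p - 1))"
      by (rule sym.ipow_mult[OF J _ F])
    \<comment> \<open>\<open>a\<close> collects all multipliers used so far. The trace releases p-th
      powers, so the product is completed to \<open>a ^ p\<close>; the remaining factor
      \<open>a\<close> lies in \<open>S\<close> and is absorbed by the symbolic power.\<close>
    define a where "a = ?\<Delta> ^ (c + d) * \<sigma>"
    have a: "a \<in> S" unfolding a_def by (intro S_mult S_power \<Delta>S \<sigma>)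
    then have "a ^ (p - 1) \<in> ?R" by (intro sym.R_power S_sub)
    then have "a ^ (p - 1) * ((?\<Delta> ^ d * (\<sigma> * x)) * (?\<Delta> ^ c * ?F)) \<in> sym.ipow r ?J (n * p + 1 + card (border r s) * (p - 1))"
      by (rule sym.ideal_lmult[OF sym.ideal_ipow[OF J] _ prod])
    also have "a ^ (p - 1) * ((?\<Delta> ^ d * (\<sigma> * x)) * (?\<Delta> ^ c * ?F)) = (a ^ (p - 1) * a) * (?F * x)"
      by (simp add: a_def power_add mult_ac)
    also have "a ^ (p - 1) * a = a ^ p" using p_pos by (metis Suc_diff_1 power_Suc2)
    finally have "Tr (a ^ p * (?F * x)) \<in> sym.ipow r ?J (n + 1)"
      by (intro sym.p_linear_ipow[OF finite_border bordered_R[OF sr] p_pos Tr_R Tr_add Tr_lin])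
    then have "a * Tr (?F * x) \<in> sym.ipow r ?I (n + 1)"
      using sym.ipow_mono[OF I J border_ideal_subset[OF sr]] by (auto simp: Tr_lin)
    then show "Tr (?F * x) \<in> sp (n + 1)"
      using a x F_R unfolding sp_iff by (blast intro: Tr_R sym.R_mult)
  next
    fix a x :: "'k ypoly"
    show "Tr (?F * (a ^ p * x)) = a * Tr (?F * x)"
      using Tr_lin[of a "?F * x"] by (simp add: mult.left_commute)
  next
    show "CHAR('k ypoly) = p" by (rule CHAR_poly_mapping[OF p CHAR])
    show "Tr (?F * x) \<in> ?R" if "x \<in> ?R" for x
      by (rule Tr_R[OF sym.R_mult[OF F_R that]])
  qed (use p Tr_F in \<open>auto simp: distrib_left Tr_add\<close>)
  then show ?thesis by blast
qed

theorem theorem6p13: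
  fixes r t p :: nat
  assumes "r \<ge> 1"
    and "CHAR('k::field) = p" and "p > 0"
    and "F_finite p TYPE('k)"
    and "1 \<le> t" and "t \<le> r"
  shows "symbolic_F_split p (sym_poly_ring r :: 'k ypoly set) (sym_minor_ideal r t) \<and>
    F_split p (symbolic_Rees (sym_poly_ring r :: 'k ypoly set) (sym_minor_ideal r t)) \<and>
    F_split p (symbolic_gr (sym_poly_ring r :: 'k ypoly set) (sym_minor_ideal r t))"
proof -
  have "prime p" using assms prime_CHAR_semidom by blast
  moreover obtain s where s: "t = Suc s" using assms by (cases t) auto
  ultimately obtain T where "frobenius_section (sym_poly_ring r :: 'k ypoly set) (sym_minor_ideal r t) p T"
    using frobenius_section_sym_minor_ideal[of s r p, where 'k = 'k] assms by auto
  then interpret frobenius_section "sym_poly_ring r :: 'k ypoly set" "sym_minor_ideal r t" p T .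
  show ?thesis using symbolic_F_split F_split_Rees F_split_gr by blast
qed

end
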